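(* Let $g$ be three times continuously differentiable. Let $\{\mathbf u^{(j)}\}_j$ be a sequence produced by Algorithm $\mathtt{modBSSN}$ (defined in the context) converging to a limit point $\mathbf u^*$ with $\mathcal I^+(\mathbf u^* )\cup\mathcal I^-(\mathbf u^* )=\emptyset$. Then there exists an index $j_0\in\mathbb N$ such that the stepsizes satisfy $t_j=1$ for all $j\ge j_0$.
   Context: **Problem data and standing assumptions.** Let $n\in\mathbb N$, $g\colon\mathbb R^n\to\mathbb R$ strictly convex, $w_1,\dots,w_n>0$ weights, and $\gamma>0$ fixed. Define $\mathbf F\colon\mathbb R^n\to\mathbb R^n$ by $\mathbf F(\mathbf u):=\mathbf u-\mathbf S_{\gamma\mathbf w}(\mathbf u-\gamma\nabla g(\mathbf u))$, where $\mathbf S_{\boldsymbol\beta}(\mathbf u):=(\operatorname{sgn}(u_k)\max\{|u_k|-\beta_k,0\})_k$ is componentwise soft thresholding, and define $\Theta(\mathbf u):=\|\mathbf F(\mathbf u)\|_2^2$. Standing assumptions: (A1) $g$ is twice Lipschitz-continuously differentiable (twice differentiable with Lipschitz continuous Hessian), $\nabla^2 g(\mathbf u)$ is positive definite for all $\mathbf u\in\mathbb R^n$, and there exist constants $0<c_1,c_2<\infty$ with $c_1\|\mathbf h\|_2^2\le\langle\nabla^2g(\mathbf u)\mathbf h,\mathbf h\rangle\le c_2\|\mathbf h\|_2^2$ for all $\mathbf h,\mathbf u\in\mathbb R^n$. (A2) The level sets $\{\mathbf u\in\mathbb R^n:\Theta(\mathbf u)\le\Theta(\mathbf u^{(0)})\}$,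 $\mathbf u^{(0)}\in\mathbb R^n$, are compact. **Index sets.** For $\mathbf u\in\mathbb R^n$ write $p_k:=\gamma(\nabla g(\mathbf u))_k+\gamma w_k$ and $m_k:=\gamma(\nabla g(\mathbf u))_k-\gamma w_k$, and define (argument $\mathbf u$ dropped) $\mathcal A^+:=\{k:p_k<u_k\}$, $\mathcal A^-:=\{k:u_k<m_k\}$, $\mathcal I^\circ:=\{k:m_k<u_k<p_k\}$, $\mathcal I^+:=\{k:u_k=p_k\}$, $\mathcal I^-:=\{k:u_k=m_k\}$; $\mathcal A^+_+:=\{k:p_k<u_k<0\}$, $\mathcal A^-_-:=\{k:0<u_k<m_k\}$, $\mathcal I^\circ_+:=\{k:m_k<u_k<p_k<0\}$, $\mathcal I^\circ_-:=\{k:0<m_k<u_k<p_k\}$. The modified index sets are $\overline{\mathcal A^+}:=\mathcal A^+\setminus\mathcal A^+_+$, $\overline{\mathcal A^-}:=\mathcal A^-\setminus\mathcal A^-_-$, $\overline{\mathcal I^\circ}:=\mathcal I^\circ\setminus(\mathcal I^\circ_+\cup\mathcal I^\circ_-)$, $\overline{\mathcal I^+}:=\mathcal I^+\cup\mathcal A^+_+\cup\mathcal I^\circ_+$, $\overline{\mathcal I^-}:=\mathcal I^-\cup\mathcal A^-_-\cup\mathcal I^\circ_-$, and $\overline{\mathcal A}:=\overline{\mathcal A^+}\cup\overline{\mathcal A^-}$, $\overline{\mathcal I}:=\overline{\mathcal I^\circ}\cup\overline{\mathcal I^+}\cup\overline{\mathcal I^-}$. **Newton direction $\mathbf d(\mathbf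 u)$.** Let $\mathbf M:=\nabla^2g(\mathbf u)$; subscripts denote subblocks/subvectors, $\mathbf M_{\overline{\mathcal A},\overline{\mathcal A}}^{-1}:=(\mathbf M_{\overline{\mathcal A},\overline{\mathcal A}})^{-1}$, and terms belonging to empty index sets are omitted. For index sets $P,Q$ put $\mathbf H_{P,Q}:=\mathbf M_{P,Q}-\mathbf M_{P,\overline{\mathcal A}}\mathbf M_{\overline{\mathcal A},\overline{\mathcal A}}^{-1}\mathbf M_{\overline{\mathcal A},Q}$. Define $$\mathbf N:=\gamma\begin{pmatrix}\mathbf H_{\overline{\mathcal I^+},\overline{\mathcal I^+}}&-\mathbf H_{\overline{\mathcal I^+},\overline{\mathcal I^-}}\\-\mathbf H_{\overline{\mathcal I^-},\overline{\mathcal I^+}}&\mathbf H_{\overline{\mathcal I^-},\overline{\mathcal I^-}}\end{pmatrix},$$ $$\mathbf z:=\begin{pmatrix}-\gamma\mathbf H_{\overline{\mathcal I^+},\overline{\mathcal I^\circ}}\mathbf u_{\overline{\mathcal I^\circ}}-\mathbf M_{\overline{\mathcal I^+},\overline{\mathcal A}}\mathbf M_{\overline{\mathcal A},\overline{\mathcal A}}^{-1}\mathbf F(\mathbf u)_{\overline{\mathcal A}}+\mathbf F(\mathbf u)_{\overline{\mathcal I^+}}\\ \gamma\mathbf H_{\overline{\mathcal I^-},\overline{\mathcal I^\circ}}\mathbf u_{\overline{\mathcal I^\circ}}+\mathbf M_{\overline{\mathcal I^-},\overline{\mathcal A}}\mathbf M_{\overline{\mathcal A},\overline{\mathcal A}}^{-1}\mathbf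 F(\mathbf u)_{\overline{\mathcal A}}-\mathbf F(\mathbf u)_{\overline{\mathcal I^-}}\end{pmatrix}-\mathbf N\begin{pmatrix}\mathbf u_{\overline{\mathcal I^+}}\\-\mathbf u_{\overline{\mathcal I^-}}\end{pmatrix}.$$ The linear complementarity problem $\mathbf x\ge\mathbf 0$, $\mathbf N\mathbf x+\mathbf z\ge\mathbf 0$, $\langle\mathbf x,\mathbf N\mathbf x+\mathbf z\rangle=0$ has a unique solution $\mathbf x=(\mathbf x_{\overline{\mathcal I^+}},\mathbf x_{\overline{\mathcal I^-}})$. Then $\mathbf d=\mathbf d(\mathbf u)\in\mathbb R^n$ is defined by $\mathbf d_{\overline{\mathcal I^\circ}}=-\mathbf u_{\overline{\mathcal I^\circ}}$, $\mathbf d_{\overline{\mathcal I^+}}=\mathbf x_{\overline{\mathcal I^+}}-\mathbf u_{\overline{\mathcal I^+}}$, $\mathbf d_{\overline{\mathcal I^-}}=-\mathbf x_{\overline{\mathcal I^-}}-\mathbf u_{\overline{\mathcal I^-}}$, $\mathbf d_{\overline{\mathcal A}}=\frac1\gamma\mathbf M_{\overline{\mathcal A},\overline{\mathcal A}}^{-1}\big(-\gamma\mathbf M_{\overline{\mathcal A},\overline{\mathcal I}}\mathbf d_{\overline{\mathcal I}}-\mathbf F(\mathbf u)_{\overline{\mathcal A}}\big)$. **Algorithm $\mathtt{modBSSN}$.** Given $\mathbf u^{(0)}\in\mathbb R^n$, $\beta\in(0,1)$, $\sigma\in(0,\frac12)$, for $j=0,1,\dots$ set $\mathbf d^{(j)}:=\mathbf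 d(\mathbf u^{(j)})$, $t_j:=\max\{\beta^l:\ l\in\{0,1,\dots\},\ \Theta(\mathbf u^{(j)}+\beta^l\mathbf d^{(j)})\le(1-2\sigma\beta^l)\Theta(\mathbf u^{(j)})\}$ (the Armijo rule; such an $l$ exists), and $\mathbf u^{(j+1)}:=\mathbf u^{(j)}+t_j\mathbf d^{(j)}$. The iteration is considered as an infinite sequence, without termination by a tolerance. *)

theory Defs
  imports "HOL-Analysis.Analysis"
begin

section \<open>Smoothness and convexity\<close>

definition strictly_convex_on :: "'a::real_vector set \<Rightarrow> ('a \<Rightarrow> real) \<Rightarrow> bool" where
  "strictly_convex_on S f \<longleftrightarrow> convex S \<and>
     (\<forall>x\<in>S. \<forall>y\<in>S. \<forall>s>0. \<forall>t>0. x \<noteq> y \<longrightarrow> s + t = 1 \<longrightarrow>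
        f (s *\<^sub>R x + t *\<^sub>R y) < s * f x + t * f y)"

text \<open>\<open>continuously_differentiable k f\<close>: \<open>f\<close> is \<open>k\<close> times continuously differentiable on the
  whole space. In finite dimension, continuity of the derivative in operator norm is the same as
  continuity of every directional derivative, which is what the recursion uses.\<close>

primrec continuously_differentiable ::
  "nat \<Rightarrow> ('a::euclidean_space \<Rightarrow> 'b::real_normed_vector) \<Rightarrow> bool" where
  "continuously_differentiable 0 f \<longleftrightarrow> continuous_on UNIV f"
| "continuously_differentiable (Suc k) f \<longleftrightarrow>
     (\<forall>x. f differentiable (at x)) \<and>
     (\<forall>h. continuously_differentiable k (\<lambda>x. frechet_derivative f (at x) h))"

definition gradient :: "(real^'n \<Rightarrow> real) \<Rightarrow> real^'n \<Rightarrow> real^'n" where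
  "gradient g u = (\<chi> k. frechet_derivative g (at u) (axis k 1))"

definition hessian :: "(real^'n \<Rightarrow> real) \<Rightarrow> real^'n \<Rightarrow> real^'n^'n" where
  "hessian g u = jacobian (gradient g) (at u)"

definition positive_definite :: "real^'n^'n \<Rightarrow> bool" where
  "positive_definite M \<longleftrightarrow> (\<forall>h. h \<noteq> 0 \<longrightarrow> (M *v h) \<bullet> h > 0)"


section \<open>Subvectors and subblocks\<close>

text \<open>Subvectors and subblocks are represented in the full index type, padded with zeros. Sums,
  products and matrix-vector products of compatible subblocks are then the ordinary ones, and
  terms belonging to empty index sets vanish.\<close>

definition subvec :: "'n set \<Rightarrow> real^'n \<Rightarrow> real^'n" where
  "subvec P v = (\<chi> k. if k \<in> P then v $ k else 0)"

definition block :: "'n set \<Rightarrow> 'n set \<Rightarrow> real^'n^'n \<Rightarrow> real^'n^'n" where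
  "block P Q M = (\<chi> i j. if i \<in> P \<and> j \<in> Q then M $ i $ j else 0)"

text \<open>The (padded) inverse of the principal subblock of \<open>M\<close> with index set \<open>A\<close>; the identity
  matrix of that size is \<open>block A A (mat 1)\<close>.\<close>

definition block_inv :: "'n::finite set \<Rightarrow> real^'n^'n \<Rightarrow> real^'n^'n" where
  "block_inv A M = (THE B. block A A B = B \<and>
     block A A M ** B = block A A (mat 1) \<and> B ** block A A M = block A A (mat 1))"


section \<open>The fixed point residual\<close>

definition soft_threshold :: "real^'n \<Rightarrow> real^'n \<Rightarrow> real^'n" where
  "soft_threshold b u = (\<chi> k. sgn (u $ k) * max (\<bar>u $ k\<bar> - b $ k) 0)"

context
  fixes g :: "real^'n::finite \<Rightarrow> real" and w :: "real^'n" and \<gamma> :: real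
begin

definition residual :: "real^'n \<Rightarrow> real^'n" where
  "residual u = u - soft_threshold (\<gamma> *\<^sub>R w) (u - \<gamma> *\<^sub>R gradient g u)"

definition merit :: "real^'n \<Rightarrow> real" where
  "merit u = (norm (residual u))\<^sup>2"


section \<open>Index sets\<close>

definition upper :: "real^'n \<Rightarrow> 'n \<Rightarrow> real" where
  "upper u k = \<gamma> * gradient g u $ k + \<gamma> * w $ k"

definition lower :: "real^'n \<Rightarrow> 'n \<Rightarrow> real" where
  "lower u k = \<gamma> * gradient g u $ k - \<gamma> * w $ k"

definition A_plus :: "real^'n \<Rightarrow> 'n set" where
  "A_plus u = {k. upper u k < u $ k}"

definition A_minus :: "real^'n \<Rightarrow> 'n set" where
  "A_minus u = {k. u $ k < lower u k}"

definition I_zero :: "real^'n \<Rightarrow> 'n set" where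
  "I_zero u = {k. lower u k < u $ k \<and> u $ k < upper u k}"

definition I_plus :: "real^'n \<Rightarrow> 'n set" where
  "I_plus u = {k. u $ k = upper u k}"

definition I_minus :: "real^'n \<Rightarrow> 'n set" where
  "I_minus u = {k. u $ k = lower u k}"

definition A_plus_plus :: "real^'n \<Rightarrow> 'n set" where
  "A_plus_plus u = {k. upper u k < u $ k \<and> u $ k < 0}"

definition A_minus_minus :: "real^'n \<Rightarrow> 'n set" where
  "A_minus_minus u = {k. 0 < u $ k \<and> u $ k < lower u k}"

definition I_zero_plus :: "real^'n \<Rightarrow> 'n set" where
  "I_zero_plus u = {k. lower u k < u $ k \<and> u $ k < upper u k \<and> upper u k < 0}"

definition I_zero_minus :: "real^'n \<Rightarrow> 'n set" where
  "I_zero_minus u = {k. 0 < lower u k \<and> lower u k < u $ k \<and> u $ k < upper u k}"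

definition mod_A_plus :: "real^'n \<Rightarrow> 'n set" where
  "mod_A_plus u = A_plus u - A_plus_plus u"

definition mod_A_minus :: "real^'n \<Rightarrow> 'n set" where
  "mod_A_minus u = A_minus u - A_minus_minus u"

definition mod_I_zero :: "real^'n \<Rightarrow> 'n set" where
  "mod_I_zero u = I_zero u - (I_zero_plus u \<union> I_zero_minus u)"

definition mod_I_plus :: "real^'n \<Rightarrow> 'n set" where
  "mod_I_plus u = I_plus u \<union> A_plus_plus u \<union> I_zero_plus u"

definition mod_I_minus :: "real^'n \<Rightarrow> 'n set" where
  "mod_I_minus u = I_minus u \<union> A_minus_minus u \<union> I_zero_minus u"

definition mod_A :: "real^'n \<Rightarrow> 'n set" where
  "mod_A u = mod_A_plus u \<union> mod_A_minus u"

definition mod_I :: "real^'n \<Rightarrow> 'n set" where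
  "mod_I u = mod_I_zero u \<union> mod_I_plus u \<union> mod_I_minus u"


section \<open>The linear complementarity problem and the Newton direction\<close>

definition schur :: "real^'n \<Rightarrow> 'n set \<Rightarrow> 'n set \<Rightarrow> real^'n^'n" where
  "schur u P Q = (let M = hessian g u; A = mod_A u in
     block P Q M - block P A M ** block_inv A M ** block A Q M)"

text \<open>The index sets \<open>mod_I_plus u\<close> and \<open>mod_I_minus u\<close> are disjoint when \<open>\<gamma>\<close> and the weights are
  positive, so in the padded representation a block matrix or block vector over them is the sum
  of its blocks.\<close>

definition lcp_matrix :: "real^'n \<Rightarrow> real^'n^'n" where
  "lcp_matrix u = (let P = mod_I_plus u; Q = mod_I_minus u in
     \<gamma> *\<^sub>R (schur u P P - schur u P Q - schur u Q P + schur u Q Q))"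

definition lcp_vector :: "real^'n \<Rightarrow> real^'n" where
  "lcp_vector u =
    (let M = hessian g u; A = mod_A u; Z = mod_I_zero u; P = mod_I_plus u; Q = mod_I_minus u;
         F = residual u
     in (- \<gamma> *\<^sub>R (schur u P Z *v subvec Z u)
           - (block P A M ** block_inv A M) *v subvec A F + subvec P F)
        + (\<gamma> *\<^sub>R (schur u Q Z *v subvec Z u)
           + (block Q A M ** block_inv A M) *v subvec A F - subvec Q F)
        - lcp_matrix u *v (subvec P u - subvec Q u))"

definition lcp_solution :: "real^'n \<Rightarrow> real^'n" where
  "lcp_solution u = (THE x.
     subvec (mod_I_plus u \<union> mod_I_minus u) x = x \<and>
     (\<forall>k\<in>mod_I_plus u \<union> mod_I_minus u.
        0 \<le> x $ k \<and> 0 \<le> (lcp_matrix u *v x + lcp_vector u) $ k) \<and>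
     x \<bullet> (lcp_matrix u *v x + lcp_vector u) = 0)"

definition newton_dir_I :: "real^'n \<Rightarrow> real^'n" where
  "newton_dir_I u = (\<chi> k.
     if k \<in> mod_I_zero u then - u $ k
     else if k \<in> mod_I_plus u then lcp_solution u $ k - u $ k
     else if k \<in> mod_I_minus u then - lcp_solution u $ k - u $ k
     else 0)"

definition newton_dir_A :: "real^'n \<Rightarrow> real^'n" where
  "newton_dir_A u = (let M = hessian g u; A = mod_A u in
     (1 / \<gamma>) *\<^sub>R (block_inv A M *v
        (- \<gamma> *\<^sub>R (block A (mod_I u) M *v newton_dir_I u) - subvec A (residual u))))"

definition newton_dir :: "real^'n \<Rightarrow> real^'n" where
  "newton_dir u = newton_dir_I u + newton_dir_A u"


section \<open>The algorithm\<close>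

definition armijo_stepsize :: "real \<Rightarrow> real \<Rightarrow> real^'n \<Rightarrow> real" where
  "armijo_stepsize \<beta> \<sigma> u = (GREATEST t. \<exists>l::nat. t = \<beta> ^ l \<and>
     merit (u + \<beta> ^ l *\<^sub>R newton_dir u) \<le> (1 - 2 * \<sigma> * \<beta> ^ l) * merit u)"

definition modBSSN :: "real \<Rightarrow> real \<Rightarrow> (nat \<Rightarrow> real^'n) \<Rightarrow> (nat \<Rightarrow> real) \<Rightarrow> bool" where
  "modBSSN \<beta> \<sigma> u t \<longleftrightarrow> (\<forall>j.
     t j = armijo_stepsize \<beta> \<sigma> (u j) \<and>
     u (Suc j) = u j + t j *\<^sub>R newton_dir (u j))"

end

end

theory Submission
  imports Defs
begin

text \<open>Newton steps are eventually accepted because, near a root \<open>u\<close> of the residual \<open>F\<close> with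
  \<open>I_plus u = I_minus u = {}\<close>, the method is the classical Newton method for a smooth equation.

  Without ties between \<open>u $ k\<close> and its two thresholds, the branch of the soft thresholding taken by
  each coordinate is constant near \<open>u\<close>. There \<open>F\<close> has the derivative \<open>residual_deriv\<close> and, the
  Hessian being Lipschitz, a Taylor remainder of second order (\<open>residual_taylor\<close>). Two facts
  about the direction \<open>d\<close> are combined with this.

  The first is that \<open>d\<close> is a descent direction even where some coordinates carry the wrong sign
  and belong to the complementarity problem. That problem says, in terms of
  \<open>q = \<gamma> H d + F\<close>: on \<open>mod_I_plus\<close> both \<open>u + d\<close> and \<open>q\<close> are nonnegative, on \<open>mod_I_minus\<close> both are
  nonpositive, on \<open>mod_A\<close> \<open>q\<close> vanishes and on \<open>mod_I_zero\<close> \<open>u + d\<close> vanishes, and altogether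
  \<open>(u + d) \<bullet> q = 0\<close> (\<open>newton_dir_conditions\<close>). The residual is negative on \<open>mod_I_plus\<close> and positive
  on \<open>mod_I_minus\<close> up to ties, so the signs give \<open>F \<bullet> F' d \<le> - |F|\<^sup>2\<close> (\<open>residual_descent\<close>). Orthogonality
  and coercivity of the Hessian bound \<open>d\<close> (\<open>newton_dir_bound\<close>). If \<open>F\<close> did not vanish at the limit,
  the stepsizes would therefore stay away from \<open>0\<close> (\<open>armijo_uniform\<close>), so each step would decrease
  the merit function by a fixed factor below \<open>1\<close>, and its limit value could not be positive.
  Hence the limit is a root (\<open>limit_is_root\<close>).

  The second is that near a root without ties every sign is right: the residual there equals the
  upper threshold on \<open>A_plus\<close>, the lower one on \<open>A_minus\<close>, and \<open>u\<close> itself on \<open>I_zero\<close>, so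
  \<open>u\<close> is positive, negative, respectively zero strictly between the thresholds. The complementarity
  problem is empty nearby, so \<open>F' d = - F\<close> and \<open>|d| \<le> C |F|\<close> (\<open>newton_dir_classical\<close>), the full step leaves
  a residual of order \<open>|F|\<^sup>2\<close>, and since \<open>\<sigma> < 1 / 2\<close> the Armijo test holds for it
  (\<open>full_step_accepted\<close>).\<close>

section \<open>Subvectors and coercive matrices\<close>

lemma norm_matrix_vector_le: "norm (A *v x) \<le> norm A * norm x"
  for A :: "real^'n^'m" and x :: "real^'n"
proof -
  have "norm (A *v x) = L2_set (\<lambda>i. norm ((A $ i) \<bullet> x)) UNIV"
    by (simp add: norm_vec_def matrix_vector_mult_def inner_vec_def)
  also have "\<dots> \<le> L2_set (\<lambda>i. norm (A $ i) * norm x) UNIV"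
    by (intro L2_set_mono) (auto intro: Cauchy_Schwarz_ineq2)
  also have "\<dots> = norm A * norm x"
    by (simp add: norm_vec_def[of A] L2_set_left_distrib)
  finally show ?thesis .
qed

lemma subvec_nth [simp]: "subvec P v $ k = (if k \<in> P then v $ k else 0)"
  by (simp add: subvec_def)

lemma subvec_add: "subvec P (v + v') = subvec P v + subvec P v'"
  and subvec_diff: "subvec P (v - v') = subvec P v - subvec P v'"
  and subvec_minus: "subvec P (- v) = - subvec P v"
  and subvec_scaleR: "subvec P (c *\<^sub>R v) = c *\<^sub>R subvec P v"
  by (simp_all add: vec_eq_iff)

lemma subvec_subvec [simp]: "subvec P (subvec Q v) = subvec (P \<inter> Q) v"
  by (simp add: vec_eq_iff)

lemma inner_subvec_left: "subvec P x \<bullet> y = x \<bullet> subvec P y"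
  by (auto simp: inner_vec_def intro: sum.cong)

lemma norm_subvec_le: "norm (subvec P v) \<le> norm v"
  by (rule norm_le_componentwise_cart) simp

lemma block_vector_mult: "block P Q M *v v = subvec P (M *v subvec Q v)"
  by (auto simp: vec_eq_iff block_def matrix_vector_mult_def intro!: sum.cong)

text \<open>A condition on the quadratic form alone, so that nonsymmetric matrices are included; it passes
  to principal blocks and to their Schur complements.\<close>

definition coercive :: "real \<Rightarrow> real^'n^'n \<Rightarrow> bool" where
  "coercive c M \<longleftrightarrow> 0 < c \<and> (\<forall>h. c * (norm h)\<^sup>2 \<le> (M *v h) \<bullet> h)"

lemma coerciveD: "coercive c M \<Longrightarrow> c * (norm h)\<^sup>2 \<le> (M *v h) \<bullet> h"
  and coercive_pos: "coercive c M \<Longrightarrow> 0 < c"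
  by (auto simp: coercive_def)

text \<open>A padded block is singular as a matrix of full size, so the inverse is taken of the block
  completed by the identity on the complement of \<open>A\<close>. This completion commutes with the
  coordinate projection onto \<open>A\<close>, hence so does its inverse, and projecting the latter gives the
  block inverse.\<close>

lemma block_inv_exists:
  assumes M: "coercive c M"
  shows "\<exists>!B. block A A B = B \<and>
    block A A M ** B = block A A (mat 1) \<and> B ** block A A M = block A A (mat 1)"
proof -
  let ?E = "block A A (mat 1) :: real^'a^'a"
  let ?MA = "block A A M"
  define K where "K = ?MA + (mat 1 - ?E)"
  have E_vec: "?E *v v = subvec A v" for v
    by (simp add: block_vector_mult)
  have K_vec: "K *v v = subvec A (M *v subvec A v) + (v - subvec A v)" for v
    by (simp add: K_def matrix_vector_mult_add_rdistrib matrix_vector_mult_diff_rdistrib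
        block_vector_mult)
  have EE: "?E ** ?E = ?E"
    and KE: "K ** ?E = ?MA" and EK: "?E ** K = ?MA"
    by (simp_all add: matrix_eq E_vec K_vec block_vector_mult subvec_add subvec_diff
        flip: matrix_vector_mul_assoc)
  have "inj ((*v) K)"
  proof (rule linear_injective_0[THEN iffD2, rule_format])
    fix v assume v: "K *v v = 0"
    have 1: "subvec A (M *v subvec A v) = 0" "v = subvec A v"
      using v unfolding K_vec by (auto simp: vec_eq_iff split: if_splits)
    have "c * (norm v)\<^sup>2 \<le> (M *v v) \<bullet> subvec A v"
      using coerciveD[OF M, of v] 1(2) by simp
    also have "\<dots> = subvec A (M *v v) \<bullet> v"
      by (simp add: inner_subvec_left)
    also have "\<dots> = 0"
      using 1 by simp
    finally show "v = 0"
      using coercive_pos[OF M] by (simp add: mult_le_0_iff)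
  qed simp
  then obtain J where JK: "J ** K = mat 1"
    using matrix_left_invertible_injective by blast
  then have KJ: "K ** J = mat 1"
    using matrix_left_right_inverse by blast
  have JE: "J ** ?E = ?E ** J"
    by (metis EK JK KE KJ matrix_mul_assoc matrix_mul_lid matrix_mul_rid)
  define B where "B = ?E ** J"
  have block_E: "block A A X ** ?E = block A A X" "?E ** block A A X = block A A X" for X
    by (simp_all add: matrix_eq E_vec block_vector_mult flip: matrix_vector_mul_assoc)
  have JE_vec: "J *v subvec A v = subvec A (J *v v)" for v
    by (metis E_vec JE matrix_vector_mul_assoc)
  have B1: "block A A B = B"
    by (simp add: matrix_eq B_def block_vector_mult E_vec JE_vec flip: matrix_vector_mul_assoc)
  have B2: "?MA ** B = ?E"
    unfolding B_def by (metis EE KE KJ EK matrix_mul_assoc matrix_mul_rid)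
  have B3: "B ** ?MA = ?E"
    unfolding B_def by (metis EE EK JE JK KE matrix_mul_assoc matrix_mul_lid)
  show ?thesis
  proof (intro ex1I[of _ B] conjI B1 B2 B3)
    fix B' assume B': "block A A B' = B' \<and> ?MA ** B' = ?E \<and> B' ** ?MA = ?E"
    have "B' = B' ** ?E"
      using B' block_E(1)[of B'] by simp
    also have "\<dots> = B' ** ?MA ** B"
      by (simp add: B2 flip: matrix_mul_assoc)
    also have "\<dots> = B"
      using B' block_E(2)[of B] B1 by simp
    finally show "B' = B" .
  qed
qed

lemma block_inv_vector:
  assumes M: "coercive c M"
  shows "subvec A (block_inv A M *v v) = block_inv A M *v v"
    and "block_inv A M *v subvec A v = block_inv A M *v v"
    and "subvec A (M *v (block_inv A M *v v)) = subvec A v"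
proof -
  let ?B = "block_inv A M"
  have B: "block A A ?B = ?B" "block A A M ** ?B = block A A (mat 1)"
    using theI'[OF block_inv_exists[OF M, of A]] unfolding block_inv_def by auto
  have 1: "?B *v v = subvec A (?B *v subvec A v)" for v
    by (metis B(1) block_vector_mult)
  show 2: "subvec A (?B *v v) = ?B *v v"
    using 1[of v] by (metis Int_absorb subvec_subvec)
  show "?B *v subvec A v = ?B *v v"
    by (metis 1 Int_absorb subvec_subvec)
  have "block A A M *v (?B *v v) = subvec A v"
    by (simp add: matrix_vector_mul_assoc B block_vector_mult)
  then show "subvec A (M *v (?B *v v)) = subvec A v"
    by (simp add: block_vector_mult 2)
qed

text \<open>The Schur complement as an operator on full vectors: the blocks \<open>schur u P Q\<close> are its
  compressions to \<open>P\<close> and \<open>Q\<close>.\<close>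

definition schur_apply :: "'n set \<Rightarrow> real^'n^'n \<Rightarrow> real^'n \<Rightarrow> real^'n" where
  "schur_apply A M v = M *v (v - block_inv A M *v (M *v v))"

lemma schur_apply_diff: "schur_apply A M (x - y) = schur_apply A M x - schur_apply A M y"
  and schur_apply_add: "schur_apply A M (x + y) = schur_apply A M x + schur_apply A M y"
  by (simp_all add: schur_apply_def algebra_simps)

text \<open>Eliminating the coordinates in \<open>A\<close> replaces \<open>x\<close> by \<open>x - b\<close>, with \<open>b\<close> supported on \<open>A\<close> and the
  \<open>A\<close>-part of \<open>M (x - b)\<close> equal to zero. So the two quadratic forms agree, while \<open>b\<close> is orthogonal to
  \<open>x\<close> and can only increase the norm.\<close>

lemma schur_apply_coercive:
  assumes M: "coercive c M" and x: "subvec A x = 0"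
  shows "c * (norm x)\<^sup>2 \<le> schur_apply A M x \<bullet> x"
proof -
  define b where "b = block_inv A M *v (M *v x)"
  have b: "subvec A b = b" and Mb: "subvec A (M *v b) = subvec A (M *v x)"
    unfolding b_def using block_inv_vector[OF M] by auto
  have bx: "b \<bullet> x = 0"
    using b x by (metis inner_subvec_left inner_zero_right)
  have "(norm x)\<^sup>2 \<le> (norm (x - b))\<^sup>2"
    by (simp add: power2_norm_eq_inner inner_diff inner_commute[of x b] bx)
  then have "c * (norm x)\<^sup>2 \<le> c * (norm (x - b))\<^sup>2"
    using coercive_pos[OF M] by simp
  also have "\<dots> \<le> (M *v (x - b)) \<bullet> (x - b)"
    by (rule coerciveD[OF M])
  also have "\<dots> = (M *v (x - b)) \<bullet> x - subvec A (M *v (x - b)) \<bullet> b"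
    by (simp add: inner_diff_right inner_subvec_left b)
  also have "subvec A (M *v (x - b)) = 0"
    by (simp add: matrix_vector_mult_diff_distrib subvec_diff Mb)
  finally show ?thesis
    by (simp add: schur_apply_def b_def)
qed

section \<open>Linear complementarity problems\<close>

text \<open>A vector solves the problem iff it is a fixed point of \<open>x \<mapsto> max 0 (x - \<tau> (N x + z))\<close> on the
  coordinates in \<open>R\<close>, for any \<open>\<tau> > 0\<close>. Taking the positive part is nonexpansive and, \<open>N\<close> being coercive,
  \<open>x - \<tau> N x\<close> is a contraction for small \<open>\<tau>\<close>; Banach's theorem gives existence. Two solutions \<open>x\<close> and \<open>y\<close> satisfy
  \<open>(y - x) \<bullet> N (y - x) \<le> 0\<close>, hence agree.\<close>

lemma lcp_ex1:
  fixes N :: "real^'n^'n" and z :: "real^'n"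
  assumes c: "0 < c" and N: "\<And>x. subvec R x = x \<Longrightarrow> c * (norm x)\<^sup>2 \<le> (N *v x) \<bullet> x"
  shows "\<exists>!x. subvec R x = x \<and> (\<forall>k\<in>R. 0 \<le> x $ k \<and> 0 \<le> (N *v x + z) $ k) \<and>
    x \<bullet> (N *v x + z) = 0"
proof -
  \<comment> \<open>The squared contraction factor \<open>1 - 2 \<tau> c + \<tau>\<^sup>2 K\<^sup>2\<close> is smallest at \<open>\<tau> = c / K\<^sup>2\<close>; including
    \<open>c\<close> in \<open>K\<close> keeps \<open>K\<close> positive and the factor at most \<open>1\<close>.\<close>
  define K where "K = c + norm N"
  define \<tau> where "\<tau> = c / K\<^sup>2"
  define q where "q = sqrt (1 - (c / K)\<^sup>2)"
  have K: "0 < K" "c \<le> K" "norm N \<le> K"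
    using c by (auto simp: K_def add_pos_nonneg)
  have \<tau>: "0 < \<tau>"
    using c K by (simp add: \<tau>_def)
  have cK: "0 < c / K" "c / K \<le> 1"
    using c K by auto
  then have cK2: "0 < (c / K)\<^sup>2" "(c / K)\<^sup>2 \<le> 1"
    by (auto simp: power_le_one)
  have q: "0 \<le> q" "q < 1"
    unfolding q_def using cK2 by auto
  define f where "f x = (\<chi> k. if k \<in> R
      then max 0 (x $ k - \<tau> * (N *v subvec R x + z) $ k) else 0)" for x
  have contraction: "dist (f x) (f y) \<le> q * dist x y" for x y
  proof -
    define h where "h = subvec R (x - y)"
    have h: "subvec R h = h" and hn: "norm h \<le> norm (x - y)"
      by (auto simp: h_def norm_subvec_le)
    have "norm (f x - f y) \<le> norm (h - \<tau> *\<^sub>R (N *v h))"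
    proof (rule norm_le_componentwise_cart)
      fix k
      have Nh: "(N *v h) $ k = (N *v subvec R x) $ k - (N *v subvec R y) $ k"
        by (simp add: h_def subvec_diff matrix_vector_mult_diff_distrib)
      have hk: "h $ k = x $ k - y $ k" if "k \<in> R"
        using that by (simp add: h_def)
      have "(h - \<tau> *\<^sub>R (N *v h)) $ k
          = (x $ k - \<tau> * (N *v subvec R x + z) $ k) - (y $ k - \<tau> * (N *v subvec R y + z) $ k)"
        if "k \<in> R"
        using that by (simp add: Nh hk algebra_simps)
      then show "norm ((f x - f y) $ k) \<le> norm ((h - \<tau> *\<^sub>R (N *v h)) $ k)"
        by (auto simp: f_def)
    qed
    moreover have "(norm (h - \<tau> *\<^sub>R (N *v h)))\<^sup>2 \<le> (q * norm h)\<^sup>2"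
    proof -
      have "(norm (h - \<tau> *\<^sub>R (N *v h)))\<^sup>2
          = (norm h)\<^sup>2 - 2 * \<tau> * ((N *v h) \<bullet> h) + \<tau>\<^sup>2 * (norm (N *v h))\<^sup>2"
        unfolding power2_norm_eq_inner
        by (simp add: inner_diff inner_commute power2_eq_square algebra_simps)
      also have "\<dots> \<le> (norm h)\<^sup>2 - 2 * \<tau> * (c * (norm h)\<^sup>2) + \<tau>\<^sup>2 * (K * norm h)\<^sup>2"
      proof (intro add_mono diff_mono order_refl mult_left_mono power_mono N[OF h])
        show "norm (N *v h) \<le> K * norm h"
          using norm_matrix_vector_le[of N h] K(3) by (meson mult_right_mono norm_ge_zero order_trans)
      qed (use \<tau> in auto)
      also have "\<dots> = (1 - (c / K)\<^sup>2) * (norm h)\<^sup>2"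
        using K by (simp add: \<tau>_def field_simps power2_eq_square)
      also have "\<dots> = (q * norm h)\<^sup>2"
        using cK2 by (simp add: q_def power_mult_distrib)
      finally show ?thesis .
    qed
    then have "norm (h - \<tau> *\<^sub>R (N *v h)) \<le> q * norm h"
      by (rule power2_le_imp_le) (simp add: q)
    moreover have "q * norm h \<le> q * norm (x - y)"
      using hn q by (simp add: mult_left_mono)
    ultimately show ?thesis
      by (simp add: dist_norm)
  qed
  obtain x where x: "f x = x"
    using banach_fix_type[OF q, of f] contraction by blast
  have xR: "subvec R x = x"
    using x by (simp add: vec_eq_iff f_def) metis
  have xk: "x $ k = max 0 (x $ k - \<tau> * (N *v x + z) $ k)" if "k \<in> R" for k
  proof -
    have "x $ k = f x $ k"
      by (simp add: x)
    then show ?thesis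
      using that by (simp add: f_def xR)
  qed
  have max_fixed: "0 \<le> a \<and> 0 \<le> b \<and> a * b = 0" if "a = max 0 (a - \<tau> * b)" for a b
  proof (cases "0 \<le> a - \<tau> * b")
    case True
    then show ?thesis
      using that \<tau> by (simp add: max_def split: if_splits)
  next
    case False
    then have "a = 0" "0 < \<tau> * b"
      using that by (auto simp: max_def)
    then show ?thesis
      using \<tau> by (simp add: zero_less_mult_iff)
  qed
  have comp: "0 \<le> x $ k" "0 \<le> (N *v x + z) $ k" "x $ k * (N *v x + z) $ k = 0" if "k \<in> R" for k
    using max_fixed[OF xk[OF that]] by auto
  have supp: "a $ k = 0" if "subvec R a = a" "k \<notin> R" for a :: "real^'n" and k
    using arg_cong[OF that(1), of "\<lambda>v. v $ k"] that(2) by simp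
  have x0: "x \<bullet> (N *v x + z) = 0"
    unfolding inner_vec_def
  proof (intro sum.neutral ballI)
    fix k
    show "x $ k \<bullet> (N *v x + z) $ k = 0"
      using comp(3)[of k] supp[OF xR, of k] by (cases "k \<in> R") auto
  qed
  show ?thesis
  proof (intro ex1I[of _ x] conjI ballI xR x0 comp)
    fix y assume y: "subvec R y = y \<and> (\<forall>k\<in>R. 0 \<le> y $ k \<and> 0 \<le> (N *v y + z) $ k) \<and>
      y \<bullet> (N *v y + z) = 0"
    have nonneg: "0 \<le> a \<bullet> b" if "subvec R a = a" "\<forall>k\<in>R. 0 \<le> a $ k \<and> 0 \<le> b $ k" for a b :: "real^'n"
      unfolding inner_vec_def
    proof (intro sum_nonneg)
      fix k
      show "0 \<le> a $ k \<bullet> b $ k"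
        using that(2) supp[OF that(1), of k] by (cases "k \<in> R") auto
    qed
    have "c * (norm (y - x))\<^sup>2 \<le> (N *v (y - x)) \<bullet> (y - x)"
      using y xR by (intro N) (simp add: subvec_diff)
    also have "\<dots> = ((N *v y + z) - (N *v x + z)) \<bullet> (y - x)"
      by (simp add: matrix_vector_mult_diff_distrib)
    also have "\<dots> = - (x \<bullet> (N *v y + z)) - y \<bullet> (N *v x + z)"
      using y x0 by (simp only: inner_diff inner_commute)
    also have "\<dots> \<le> 0"
      using nonneg[of x "N *v y + z"] nonneg[of y "N *v x + z"] y xR comp by auto
    finally show "y = x"
      using c by (simp add: mult_le_0_iff)
  qed
qed

section \<open>Optimality conditions for the Newton direction\<close>

lemma residual_max:
  assumes "\<And>k. 0 < w $ k" "0 < \<gamma>"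
  shows "residual g w \<gamma> u $ k =
    u $ k - max (u $ k - upper g w \<gamma> u k) 0 + max (lower g w \<gamma> u k - u $ k) 0"
proof -
  have "0 < \<gamma> * w $ k"
    using assms by simp
  moreover have "sgn x * max (\<bar>x\<bar> - b) 0 = max (x - b) 0 - max (- x - b) 0" if "0 < b" for x b :: real
    using that by (auto simp: sgn_if max_def)
  ultimately have "residual g w \<gamma> u $ k = u $ k -
      (max (u $ k - \<gamma> * gradient g u $ k - \<gamma> * w $ k) 0 -
       max (- (u $ k - \<gamma> * gradient g u $ k) - \<gamma> * w $ k) 0)"
    by (simp add: residual_def soft_threshold_def)
  then show ?thesis
    by (simp add: upper_def lower_def algebra_simps)
qed

lemma lower_less_upper:
  assumes "\<And>k. 0 < w $ k" "0 < \<gamma>"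
  shows "lower g w \<gamma> u k < upper g w \<gamma> u k"
proof -
  have "0 < \<gamma> * w $ k"
    using assms by simp
  then show ?thesis
    by (simp add: lower_def upper_def)
qed

lemma mod_index_sets_partition:
  assumes "\<And>k. 0 < w $ k" "0 < \<gamma>"
  shows "mod_A g w \<gamma> u \<inter> mod_I g w \<gamma> u = {}"
    and "mod_A g w \<gamma> u \<union> mod_I g w \<gamma> u = UNIV"
    and "mod_I_zero g w \<gamma> u \<inter> mod_I_plus g w \<gamma> u = {}"
    and "mod_I_zero g w \<gamma> u \<inter> mod_I_minus g w \<gamma> u = {}"
    and "mod_I_plus g w \<gamma> u \<inter> mod_I_minus g w \<gamma> u = {}"
proof -
  note lt = lower_less_upper[OF assms, of g u]
  note defs = mod_A_def mod_I_def mod_A_plus_def mod_A_minus_def mod_I_zero_def mod_I_plus_def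
    mod_I_minus_def A_plus_def A_minus_def I_zero_def I_plus_def I_minus_def A_plus_plus_def
    A_minus_minus_def I_zero_plus_def I_zero_minus_def
  have "(k \<in> mod_A g w \<gamma> u \<longleftrightarrow> k \<notin> mod_I g w \<gamma> u) \<and>
      \<not> (k \<in> mod_I_zero g w \<gamma> u \<and> k \<in> mod_I_plus g w \<gamma> u) \<and>
      \<not> (k \<in> mod_I_zero g w \<gamma> u \<and> k \<in> mod_I_minus g w \<gamma> u) \<and>
      \<not> (k \<in> mod_I_plus g w \<gamma> u \<and> k \<in> mod_I_minus g w \<gamma> u)" for k
    using lt[of k] unfolding defs by (simp only: mem_Collect_eq Diff_iff Un_iff) linarith
  then show "mod_A g w \<gamma> u \<inter> mod_I g w \<gamma> u = {}"
    "mod_A g w \<gamma> u \<union> mod_I g w \<gamma> u = UNIV"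
    "mod_I_zero g w \<gamma> u \<inter> mod_I_plus g w \<gamma> u = {}"
    "mod_I_zero g w \<gamma> u \<inter> mod_I_minus g w \<gamma> u = {}"
    "mod_I_plus g w \<gamma> u \<inter> mod_I_minus g w \<gamma> u = {}"
    by blast+
qed

text \<open>With \<open>S\<close> the sign matrix that is \<open>1\<close> on \<open>mod_I_plus\<close>, \<open>-1\<close> on \<open>mod_I_minus\<close> and \<open>0\<close> elsewhere, and \<open>G\<close>
  the Schur complement, the matrix of the complementarity problem is \<open>\<gamma> S G S\<close>, and its vector is
  such that \<open>N x + z = S q\<close>, where \<open>u + d = S x\<close> off \<open>mod_A\<close>. Eliminating the coordinates in \<open>mod_A\<close> thus
  only hides the residual \<open>q\<close> of the linearised equation; the conditions below are the
  complementarity problem before this elimination. The orthogonality in the last one extends from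
  the support of \<open>x\<close> to all coordinates because elsewhere \<open>q\<close> or \<open>u + d\<close> vanishes.\<close>

lemma newton_dir_conditions:
  fixes u :: "real^'n::finite"
  assumes w: "\<And>k. 0 < w $ k" and \<gamma>: "0 < \<gamma>" and M: "coercive c (hessian g u)"
  defines "d \<equiv> newton_dir g w \<gamma> u"
  defines "q \<equiv> \<gamma> *\<^sub>R (hessian g u *v newton_dir g w \<gamma> u) + residual g w \<gamma> u"
  shows "k \<in> mod_A g w \<gamma> u \<Longrightarrow> q $ k = 0"
    and "k \<in> mod_I_zero g w \<gamma> u \<Longrightarrow> d $ k = - u $ k"
    and "k \<in> mod_I_plus g w \<gamma> u \<Longrightarrow> 0 \<le> (u + d) $ k \<and> 0 \<le> q $ k"
    and "k \<in> mod_I_minus g w \<gamma> u \<Longrightarrow> (u + d) $ k \<le> 0 \<and> q $ k \<le> 0"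
    and "(u + d) \<bullet> q = 0"
proof -
  define A where "A = mod_A g w \<gamma> u"
  define Z where "Z = mod_I_zero g w \<gamma> u"
  define P where "P = mod_I_plus g w \<gamma> u"
  define Q where "Q = mod_I_minus g w \<gamma> u"
  define M where "M = hessian g u"
  define B where "B = block_inv A M"
  define r where "r = residual g w \<gamma> u"
  define x where "x = lcp_solution g w \<gamma> u"
  define dI where "dI = newton_dir_I g w \<gamma> u"
  define dA where "dA = newton_dir_A g w \<gamma> u"
  define S where "S v = subvec P v - subvec Q v" for v :: "real^'n"
  define G where "G = schur_apply A M"
  note ABM = A_def[symmetric] M_def[symmetric] Z_def[symmetric] P_def[symmetric] Q_def[symmetric]
    r_def[symmetric]
  have coer: "coercive c M"
    using M by (simp add: M_def)
  have part: "A \<inter> mod_I g w \<gamma> u = {}" "A \<union> mod_I g w \<gamma> u = UNIV" "mod_I g w \<gamma> u = Z \<union> P \<union> Q"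
    "Z \<inter> P = {}" "Z \<inter> Q = {}" "P \<inter> Q = {}"
    using mod_index_sets_partition[OF w \<gamma>, of g u]
    by (simp_all add: A_def Z_def P_def Q_def mod_I_def)
  have BA: "subvec A (B *v v) = B *v v" "B *v subvec A v = B *v v"
    "subvec A (M *v (B *v v)) = subvec A v" for v
    unfolding B_def using block_inv_vector[OF coer] by auto
  have schur: "schur g w \<gamma> u X Y *v v = subvec X (G (subvec Y v))" for X Y v
    by (simp add: schur_def Let_def ABM B_def[symmetric] G_def schur_apply_def
        matrix_vector_mult_diff_rdistrib matrix_vector_mult_diff_distrib block_vector_mult
        subvec_diff BA flip: matrix_vector_mul_assoc)
  have G_diff: "G (v - v') = G v - G v'" for v v'
    by (simp add: G_def schur_apply_diff)
  have G_add: "G (v + v') = G v + G v'" for v v'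
    by (simp add: G_def schur_apply_add)
  have N: "lcp_matrix g w \<gamma> u *v v = \<gamma> *\<^sub>R S (G (S v))" for v
    by (simp add: lcp_matrix_def Let_def ABM S_def G_diff subvec_diff
        matrix_vector_mult_diff_rdistrib matrix_vector_mult_add_rdistrib schur
        flip: scaleR_matrix_vector_assoc)
  have SS: "S (S v) = subvec P v + subvec Q v" for v
    using part(6) by (auto simp: S_def vec_eq_iff)
  have S_lin: "S (v + v') = S v + S v'" "S (v - v') = S v - S v'" "S (a *\<^sub>R v) = a *\<^sub>R S v"
    for v v' a
    by (simp_all add: S_def subvec_add subvec_diff subvec_scaleR algebra_simps)
  have S_adj: "S v \<bullet> v' = v \<bullet> S v'" for v v'
    by (simp add: S_def inner_diff inner_subvec_left)
  \<comment> \<open>\<open>q\<close> with \<open>d\<close> replaced by its definition in terms of the solution \<open>x\<close>\<close>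
  define q' where "q' = \<gamma> *\<^sub>R G (S x - subvec Z u - S (S u)) - M *v (B *v r) + r"
  have z: "lcp_vector g w \<gamma> u = S (r - \<gamma> *\<^sub>R G (subvec Z u) - M *v (B *v r)) - \<gamma> *\<^sub>R S (G (S (S u)))"
  proof -
    have "lcp_vector g w \<gamma> u
        = S (r - \<gamma> *\<^sub>R G (subvec Z u) - M *v (B *v r)) - lcp_matrix g w \<gamma> u *v S u"
      by (simp add: lcp_vector_def Let_def ABM S_def B_def[symmetric] schur block_vector_mult BA
          subvec_add subvec_diff subvec_scaleR algebra_simps flip: matrix_vector_mul_assoc)
    then show ?thesis
      by (simp add: N)
  qed
  have Nz: "lcp_matrix g w \<gamma> u *v x + lcp_vector g w \<gamma> u = S q'"
    by (simp add: N z q'_def S_lin G_diff G_add algebra_simps)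
  have Ncoer: "(\<gamma> * c) * (norm y)\<^sup>2 \<le> (lcp_matrix g w \<gamma> u *v y) \<bullet> y" if y: "subvec (P \<union> Q) y = y" for y
  proof -
    have "S (S y) = y"
      using y part(6) unfolding SS by (auto simp: vec_eq_iff split: if_splits)
    then have "(norm (S y))\<^sup>2 = (norm y)\<^sup>2"
      by (simp add: power2_norm_eq_inner S_adj)
    moreover have "subvec A (S y) = 0"
      using part(1,3) by (auto simp: S_def vec_eq_iff)
    ultimately have "c * (norm y)\<^sup>2 \<le> G (S y) \<bullet> S y"
      unfolding G_def by (metis schur_apply_coercive[OF coer])
    then show ?thesis
      using \<gamma> by (simp add: N S_adj)
  qed
  have "0 < \<gamma> * c"
    using \<gamma> coercive_pos[OF coer] by simp
  then have "\<exists>!x. subvec (P \<union> Q) x = x \<and>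
      (\<forall>k\<in>P \<union> Q. 0 \<le> x $ k \<and> 0 \<le> (lcp_matrix g w \<gamma> u *v x + lcp_vector g w \<gamma> u) $ k) \<and>
      x \<bullet> (lcp_matrix g w \<gamma> u *v x + lcp_vector g w \<gamma> u) = 0"
    by (rule lcp_ex1) (rule Ncoer)
  from theI'[OF this]
  have x: "subvec (P \<union> Q) x = x" "\<And>k. k \<in> P \<union> Q \<Longrightarrow> 0 \<le> x $ k \<and> 0 \<le> S q' $ k" "x \<bullet> S q' = 0"
    unfolding x_def[unfolded lcp_solution_def ABM, symmetric] Nz by auto
  have dI: "dI = S x - subvec Z u - S (S u)"
    using part(4-6) unfolding SS S_def dI_def newton_dir_I_def ABM x_def[symmetric]
    by (auto simp: vec_eq_iff)
  have dI_I: "subvec (mod_I g w \<gamma> u) dI = dI"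
    using part(3) unfolding dI SS S_def by (auto simp: vec_eq_iff)
  have B_minus: "B *v (- v) = - (B *v v)" for v
    using matrix_vector_mult_diff_distrib[of B 0 v] by simp
  have dA: "dA = - (B *v (M *v dI)) - (1 / \<gamma>) *\<^sub>R (B *v r)"
    using \<gamma> unfolding dA_def newton_dir_A_def Let_def ABM B_def[symmetric] dI_def[symmetric]
    by (simp add: block_vector_mult dI_I BA matrix_vector_mult_diff_distrib
        matrix_vector_mult_scaleR B_minus scaleR_diff_right flip: subvec_scaleR)
  have d: "d = dI + dA"
    by (simp add: d_def newton_dir_def dI_def dA_def)
  have q: "q = \<gamma> *\<^sub>R (M *v d) + r"
    by (simp add: q_def M_def d_def r_def)
  have "q = q'"
    using \<gamma> unfolding q q'_def dI[symmetric] d dA G_def schur_apply_def B_def[symmetric]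
    by (simp add: algebra_simps matrix_vector_mult_scaleR)
  note x = x[folded \<open>q = q'\<close>]
  have qA: "subvec A q = 0"
    unfolding \<open>q = q'\<close> q'_def G_def schur_apply_def B_def[symmetric]
    by (simp add: subvec_add subvec_diff subvec_scaleR BA matrix_vector_mult_diff_distrib)
  have dAA: "subvec A dA = dA"
    unfolding dA by (simp add: subvec_diff subvec_minus subvec_scaleR BA)
  have ud: "u + d = S x + subvec A (u + d)"
  proof (rule vec_eq_iff[THEN iffD2, rule_format])
    fix k
    show "(u + d) $ k = (S x + subvec A (u + d)) $ k"
      using part arg_cong[OF dAA, of "\<lambda>v. v $ k"] unfolding d dI SS S_def
      by (cases "k \<in> A") (auto split: if_splits)
  qed
  show "q $ k = 0" if "k \<in> mod_A g w \<gamma> u"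
    using arg_cong[OF qA, of "\<lambda>v. v $ k"] that by (simp add: A_def)
  have ud_nth: "u $ k + d $ k = (if k \<in> P then x $ k else 0) - (if k \<in> Q then x $ k else 0)"
    if "k \<notin> A" for k
    using arg_cong[OF ud, of "\<lambda>v. v $ k"] that by (simp add: S_def)
  have not_A: "k \<notin> A" if "k \<in> Z \<union> P \<union> Q"
    using that part(1,3) by blast
  show "d $ k = - u $ k" if "k \<in> mod_I_zero g w \<gamma> u"
  proof -
    have "k \<in> Z" "k \<notin> P" "k \<notin> Q"
      using that part(4,5) by (auto simp: ABM)
    then show ?thesis
      using ud_nth[of k] not_A by simp
  qed
  show "0 \<le> (u + d) $ k \<and> 0 \<le> q $ k" if "k \<in> mod_I_plus g w \<gamma> u"
  proof -
    have "k \<in> P" "k \<notin> Q"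
      using that part(6) by (auto simp: ABM)
    then show ?thesis
      using ud_nth[of k] not_A x(2)[of k] by (simp add: S_def)
  qed
  show "(u + d) $ k \<le> 0 \<and> q $ k \<le> 0" if "k \<in> mod_I_minus g w \<gamma> u"
  proof -
    have "k \<in> Q" "k \<notin> P"
      using that part(6) by (auto simp: ABM)
    then show ?thesis
      using ud_nth[of k] not_A x(2)[of k] by (simp add: S_def)
  qed
  have "(u + d) \<bullet> q = x \<bullet> S q + (u + d) \<bullet> subvec A q"
    by (subst ud) (simp only: inner_add_left S_adj inner_subvec_left)
  then show "(u + d) \<bullet> q = 0"
    by (simp add: x qA)
qed

section \<open>The Armijo rule\<close>

text \<open>The largest admissible power has the least admissible exponent, so a greatest element exists as
  soon as one power is admissible.\<close>

lemma armijo_stepsize_ge: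
  assumes \<beta>: "0 < \<beta>" "\<beta> < 1"
    and accept: "merit g w \<gamma> (u + \<beta> ^ l *\<^sub>R newton_dir g w \<gamma> u) \<le> (1 - 2 * \<sigma> * \<beta> ^ l) * merit g w \<gamma> u"
  obtains m where "m \<le> l" "armijo_stepsize g w \<gamma> \<beta> \<sigma> u = \<beta> ^ m"
    "merit g w \<gamma> (u + \<beta> ^ m *\<^sub>R newton_dir g w \<gamma> u) \<le> (1 - 2 * \<sigma> * \<beta> ^ m) * merit g w \<gamma> u"
proof -
  define acc where "acc m \<longleftrightarrow>
    merit g w \<gamma> (u + \<beta> ^ m *\<^sub>R newton_dir g w \<gamma> u) \<le> (1 - 2 * \<sigma> * \<beta> ^ m) * merit g w \<gamma> u" for m
  define m where "m = (LEAST m. acc m)"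
  have l: "acc l"
    using accept by (simp add: acc_def)
  then have m: "acc m" "m \<le> l"
    unfolding m_def by (auto intro: LeastI Least_le)
  have "armijo_stepsize g w \<gamma> \<beta> \<sigma> u = (GREATEST t. \<exists>l. t = \<beta> ^ l \<and> acc l)"
    by (simp add: armijo_stepsize_def acc_def)
  also have "\<dots> = \<beta> ^ m"
  proof (rule Greatest_equality)
    show "\<exists>l. \<beta> ^ m = \<beta> ^ l \<and> acc l"
      using m by blast
    fix t assume "\<exists>l. t = \<beta> ^ l \<and> acc l"
    then obtain k where "t = \<beta> ^ k" "acc k"
      by blast
    moreover from this have "m \<le> k"
      unfolding m_def by (simp add: Least_le)
    ultimately show "t \<le> \<beta> ^ m"
      using \<beta> by (simp add: power_decreasing)
  qed
  finally show thesis
    using that m unfolding acc_def by blast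
qed

section \<open>The residual away from ties\<close>

lemma isCont_tendsto_nhds: "isCont f u \<Longrightarrow> (f \<longlongrightarrow> f u) (nhds u)"
  by (simp add: continuous_within tendsto_at_iff_tendsto_nhds)

definition same_regime :: "(real^'n \<Rightarrow> real) \<Rightarrow> real^'n \<Rightarrow> real \<Rightarrow> real^'n \<Rightarrow> real^'n \<Rightarrow> bool" where
  "same_regime g w \<gamma> u v \<longleftrightarrow> A_plus g w \<gamma> v = A_plus g w \<gamma> u \<and>
     A_minus g w \<gamma> v = A_minus g w \<gamma> u \<and> I_zero g w \<gamma> v = I_zero g w \<gamma> u"

definition nondegenerate :: "(real^'n \<Rightarrow> real) \<Rightarrow> real^'n \<Rightarrow> real \<Rightarrow> real^'n \<Rightarrow> bool" where
  "nondegenerate g w \<gamma> u \<longleftrightarrow> I_plus g w \<gamma> u \<union> I_minus g w \<gamma> u = {}"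

text \<open>The derivative of the residual at a point without ties, where each coordinate keeps its branch
  of the soft thresholding nearby; at other points it has no meaning.\<close>

definition residual_deriv :: "(real^'n::finite \<Rightarrow> real) \<Rightarrow> real^'n \<Rightarrow> real \<Rightarrow> real^'n \<Rightarrow> real^'n \<Rightarrow> real^'n" where
  "residual_deriv g w \<gamma> u h =
     subvec (A_plus g w \<gamma> u \<union> A_minus g w \<gamma> u) (\<gamma> *\<^sub>R (hessian g u *v h)) + subvec (I_zero g w \<gamma> u) h"

text \<open>The coercivity constant \<open>c\<close> and the Lipschitz constant \<open>L\<close> are parameters because the local
  bounds on the Newton direction and on the Taylor remainder are expressed with them.\<close>

context
  fixes g :: "real^'n::finite \<Rightarrow> real" and w :: "real^'n" and \<gamma> c L :: real
  assumes w_pos: "\<And>k. 0 < w $ k" and \<gamma>_pos: "0 < \<gamma>"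
    and gradient_differentiable: "\<And>v. gradient g differentiable (at v)"
    and hessian_lipschitz: "L-lipschitz_on UNIV (hessian g)"
    and hessian_coercive: "\<And>v. coercive c (hessian g v)"
begin

abbreviation (input) "F \<equiv> residual g w \<gamma>"
abbreviation (input) "\<Theta> \<equiv> merit g w \<gamma>"
abbreviation (input) "H \<equiv> hessian g"
abbreviation (input) "d \<equiv> newton_dir g w \<gamma>"
abbreviation (input) "J \<equiv> residual_deriv g w \<gamma>"

lemmas lt_upper = lower_less_upper[OF w_pos \<gamma>_pos, of g]
lemmas residual_nth = residual_max[OF w_pos \<gamma>_pos, of g]
lemmas newton_dir_facts = newton_dir_conditions[OF w_pos \<gamma>_pos hessian_coercive]
lemmas index_partition = mod_index_sets_partition[OF w_pos \<gamma>_pos, of g]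

lemma L_nonneg: "0 \<le> L"
  using hessian_lipschitz by (rule lipschitz_on_nonneg)

lemma c_pos: "0 < c"
  using hessian_coercive by (rule coercive_pos)

lemma gradient_has_derivative: "(gradient g has_derivative (*v) (H v)) (at v)"
  using gradient_differentiable[of v] unfolding hessian_def jacobian_works .

lemma continuous_data:
  "isCont (gradient g) v" "isCont H v" "isCont F v" "isCont \<Theta> v"
  "isCont (\<lambda>v. upper g w \<gamma> v k) v" "isCont (\<lambda>v. lower g w \<gamma> v k) v"
proof -
  show grad: "isCont (gradient g) v" for v
    using gradient_has_derivative by (rule has_derivative_continuous)
  show "isCont H v"
    using lipschitz_on_continuous_on[OF hessian_lipschitz] by (simp add: continuous_on_eq_continuous_at)
  show up: "isCont (\<lambda>v. upper g w \<gamma> v k) v" for k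
    unfolding upper_def by (intro continuous_intros grad continuous_component)
  show lo: "isCont (\<lambda>v. lower g w \<gamma> v k) v" for k
    unfolding lower_def by (intro continuous_intros grad continuous_component)
  have "isCont (\<lambda>v. F v $ k) v" for k
    unfolding residual_nth by (intro continuous_intros up lo continuous_component)
  then show F: "isCont F v"
    unfolding isCont_def by (intro vec_tendstoI)
  show "isCont \<Theta> v"
    unfolding merit_def by (intro continuous_intros F)
qed

lemma residual_cases:
  "k \<in> A_plus g w \<gamma> u \<Longrightarrow> F u $ k = upper g w \<gamma> u k"
  "k \<in> A_minus g w \<gamma> u \<Longrightarrow> F u $ k = lower g w \<gamma> u k"
  "k \<in> I_zero g w \<gamma> u \<Longrightarrow> F u $ k = u $ k"
  using lt_upper[of u k]
  by (auto simp: residual_nth A_plus_def A_minus_def I_zero_def max_def)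

lemma regime_disjoint:
  "A_plus g w \<gamma> u \<inter> A_minus g w \<gamma> u = {}" "A_plus g w \<gamma> u \<inter> I_zero g w \<gamma> u = {}"
  "A_minus g w \<gamma> u \<inter> I_zero g w \<gamma> u = {}"
  using lt_upper[of u] unfolding A_plus_def A_minus_def I_zero_def
  by (auto simp: not_less) (smt (verit))

lemma nondegenerate_cover:
  "nondegenerate g w \<gamma> u \<Longrightarrow> A_plus g w \<gamma> u \<union> A_minus g w \<gamma> u \<union> I_zero g w \<gamma> u = UNIV"
  unfolding nondegenerate_def A_plus_def A_minus_def I_zero_def I_plus_def I_minus_def
  by (auto simp: set_eq_iff) (metis linorder_less_linear)+

text \<open>Without ties the index sets are described by strict inequalities between continuous
  functions, which persist nearby.\<close>

lemma eventually_same_regime: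
  assumes "nondegenerate g w \<gamma> u"
  shows "\<forall>\<^sub>F v in nhds u. nondegenerate g w \<gamma> v \<and> same_regime g w \<gamma> u v"
proof -
  have ev: "\<forall>\<^sub>F v in nhds u. a v < b v" if "isCont a u" "isCont b u" "a u < b u"
    for a b :: "real^'n \<Rightarrow> real"
  proof -
    have "((\<lambda>v. a v - b v) \<longlongrightarrow> a u - b u) (nhds u)"
      using that by (intro tendsto_diff isCont_tendsto_nhds)
    from order_tendstoD(2)[OF this, of 0] that(3) show ?thesis
      by simp
  qed
  have comp: "isCont (\<lambda>v. v $ k) u" for k
    by (intro continuous_intros continuous_component)
  have "\<forall>\<^sub>F v in nhds u. \<forall>k.
      (upper g w \<gamma> u k < u $ k \<longrightarrow> upper g w \<gamma> v k < v $ k) \<and>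
      (u $ k < lower g w \<gamma> u k \<longrightarrow> v $ k < lower g w \<gamma> v k) \<and>
      (u $ k < upper g w \<gamma> u k \<longrightarrow> v $ k < upper g w \<gamma> v k) \<and>
      (lower g w \<gamma> u k < u $ k \<longrightarrow> lower g w \<gamma> v k < v $ k)"
    by (intro eventually_all_finite eventually_conj)
      (cases rule: case_split, auto intro: ev comp continuous_data)+
  then show ?thesis
  proof eventually_elim
    case (elim v)
    have "u $ k \<noteq> upper g w \<gamma> u k" "u $ k \<noteq> lower g w \<gamma> u k" for k
      using assms by (auto simp: nondegenerate_def I_plus_def I_minus_def)
    then show ?case
      using elim unfolding nondegenerate_def same_regime_def A_plus_def A_minus_def I_zero_def
        I_plus_def I_minus_def
      by (simp add: set_eq_iff) (smt (verit))
  qed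
qed

lemma gradient_taylor:
  "norm (gradient g (v + h) - gradient g v - H v *v h) \<le> L * (norm h)\<^sup>2"
proof -
  have "norm (gradient g (v + h) - gradient g v - H v *v ((v + h) - v))
      \<le> norm ((v + h) - v) * (L * norm h)"
  proof (rule differentiable_bound_linearization[where S = "cball v (norm h)"
        and f' = "\<lambda>x. (*v) (H x)" and ?x0.0 = v and a = v])
    show "v + t *\<^sub>R (v + h - v) \<in> cball v (norm h)" if "t \<in> {0..1}" for t
      using that by (auto simp: dist_norm mult_left_le_one_le)
    show "(gradient g has_derivative (*v) (H x)) (at x within cball v (norm h))"
      if "x \<in> cball v (norm h)" for x
      by (rule has_derivative_at_withinI[OF gradient_has_derivative])
    fix x assume x: "x \<in> cball v (norm h)"
    have "norm ((H x - H v) *v y) \<le> (L * norm h) * norm y" for y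
    proof -
      have "norm (H x - H v) \<le> L * norm h"
        using lipschitz_onD[OF hessian_lipschitz, of x v] x L_nonneg
        by (simp add: dist_norm norm_minus_commute) (meson mult_left_mono order_trans)
      then show ?thesis
        using norm_matrix_vector_le[of "H x - H v" y] by (meson mult_right_mono norm_ge_zero order_trans)
    qed
    then show "onorm ((*v) (H x) - (*v) (H v)) \<le> L * norm h"
      by (intro onorm_le) (simp add: matrix_vector_mult_diff_rdistrib)
  qed simp
  then show ?thesis
    by (simp add: power2_eq_square mult_ac)
qed

text \<open>On a fixed branch every component of the residual is affine in the point or in the gradient, so
  the remainder is that of the gradient.\<close>

lemma residual_taylor:
  assumes nd: "nondegenerate g w \<gamma> v" and same: "same_regime g w \<gamma> v (v + h)"
  shows "norm (F (v + h) - F v - J v h) \<le> \<gamma> * L * (norm h)\<^sup>2"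
proof -
  let ?e = "gradient g (v + h) - gradient g v - H v *v h"
  have "F (v + h) - F v - J v h = \<gamma> *\<^sub>R subvec (A_plus g w \<gamma> v \<union> A_minus g w \<gamma> v) ?e"
  proof (rule vec_eq_iff[THEN iffD2, rule_format])
    fix k
    consider "k \<in> A_plus g w \<gamma> v" | "k \<in> A_minus g w \<gamma> v" | "k \<in> I_zero g w \<gamma> v"
      using nondegenerate_cover[OF nd] by blast
    then show "(F (v + h) - F v - J v h) $ k
        = (\<gamma> *\<^sub>R subvec (A_plus g w \<gamma> v \<union> A_minus g w \<gamma> v) ?e) $ k"
      using regime_disjoint[of v] residual_cases[of k v] residual_cases[of k "v + h"] same
      unfolding same_regime_def residual_deriv_def
      by cases (auto simp: upper_def lower_def algebra_simps)
  qed
  then have "norm (F (v + h) - F v - J v h) \<le> \<gamma> * norm ?e"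
    using \<gamma>_pos norm_subvec_le by simp
  also have "\<dots> \<le> \<gamma> * (L * (norm h)\<^sup>2)"
    using \<gamma>_pos gradient_taylor by simp
  finally show ?thesis
    by simp
qed

text \<open>On the coordinates of the complementarity problem the linearised equation is replaced by an
  inequality, which always points in the favourable direction: on \<open>mod_I_plus\<close> the residual is negative and
  \<open>(F' d) $ k \<ge> - F $ k\<close>, on \<open>mod_I_minus\<close> both signs are reversed. Multiplying by \<open>F $ k\<close> gives the
  same upper bound in both cases as the exact equation does on the other coordinates.\<close>

lemma residual_descent:
  assumes nd: "nondegenerate g w \<gamma> v"
  shows "F v \<bullet> J v (d v) \<le> - (norm (F v))\<^sup>2"
proof -
  have "F v $ k * J v (d v) $ k \<le> - (F v $ k * F v $ k)" for k
  proof -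
    define q where "q = \<gamma> *\<^sub>R (H v *v d v) + F v"
    note facts = newton_dir_facts[where u = v, folded q_def]
    have act: "J v (d v) $ k = q $ k - F v $ k" if "k \<in> A_plus g w \<gamma> v \<union> A_minus g w \<gamma> v"
      using that regime_disjoint[of v] by (auto simp: residual_deriv_def q_def)
    have ina: "J v (d v) $ k = d v $ k" "F v $ k = v $ k" if "k \<in> I_zero g w \<gamma> v"
      using that regime_disjoint[of v] residual_cases(3) by (auto simp: residual_deriv_def)
    have *: "a * b \<le> - (a * a)" if "a \<le> 0 \<and> - a \<le> b \<or> 0 \<le> a \<and> b \<le> - a" for a b :: real
      using that mult_left_mono_neg[of "- a" b a] mult_left_mono[of b "- a" a] by auto
    consider "k \<in> mod_A g w \<gamma> v" | "k \<in> mod_I_zero g w \<gamma> v"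
      | "k \<in> A_plus_plus g w \<gamma> v" | "k \<in> I_zero_plus g w \<gamma> v"
      | "k \<in> A_minus_minus g w \<gamma> v" | "k \<in> I_zero_minus g w \<gamma> v"
      using index_partition(2)[of v] nd
      unfolding mod_I_def mod_I_plus_def mod_I_minus_def nondegenerate_def by blast
    then show ?thesis
    proof cases
      case 1
      then have "k \<in> A_plus g w \<gamma> v \<union> A_minus g w \<gamma> v"
        by (auto simp: mod_A_def mod_A_plus_def mod_A_minus_def)
      then show ?thesis
        using act facts(1)[OF 1] by simp
    next
      case 2
      then have "k \<in> I_zero g w \<gamma> v"
        by (auto simp: mod_I_zero_def)
      then show ?thesis
        using ina facts(2)[OF 2] by simp
    next
      case 3
      then have A: "k \<in> A_plus g w \<gamma> v" and neg: "upper g w \<gamma> v k < 0" and "k \<in> mod_I_plus g w \<gamma> v"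
        by (auto simp: A_plus_plus_def A_plus_def mod_I_plus_def)
      then show ?thesis
        using act residual_cases(1)[OF A] facts(3)[of k] by (intro *) auto
    next
      case 4
      then have A: "k \<in> I_zero g w \<gamma> v" and neg: "v $ k < 0" and "k \<in> mod_I_plus g w \<gamma> v"
        by (auto simp: I_zero_plus_def I_zero_def mod_I_plus_def)
      then show ?thesis
        using ina facts(3)[of k] by (intro *) auto
    next
      case 5
      then have A: "k \<in> A_minus g w \<gamma> v" and neg: "lower g w \<gamma> v k > 0" and "k \<in> mod_I_minus g w \<gamma> v"
        by (auto simp: A_minus_minus_def A_minus_def mod_I_minus_def)
      then show ?thesis
        using act residual_cases(2)[OF A] facts(4)[of k] by (intro *) auto
    next
      case 6
      then have A: "k \<in> I_zero g w \<gamma> v" and neg: "v $ k > 0" and "k \<in> mod_I_minus g w \<gamma> v"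
        by (auto simp: I_zero_minus_def I_zero_def mod_I_minus_def)
      then show ?thesis
        using ina facts(4)[of k] by (intro *) auto
    qed
  qed
  then have "(\<Sum>k\<in>UNIV. F v $ k * J v (d v) $ k) \<le> (\<Sum>k\<in>UNIV. - (F v $ k * F v $ k))"
    by (rule sum_mono)
  then show ?thesis
    by (simp add: power2_norm_eq_inner inner_vec_def sum_negf)
qed

text \<open>For \<open>e = v + d v\<close> the orthogonality reads \<open>\<gamma> (e \<bullet> H e) = e \<bullet> (\<gamma> H v - F)\<close>, and coercivity of the Hessian
  \<open>H\<close> turns this into a bound on \<open>e\<close>.\<close>

lemma newton_dir_bound:
  "norm (d v) \<le> norm v + (\<gamma> * norm (H v) * norm v + norm (F v)) / (\<gamma> * c)"
proof -
  define e where "e = v + d v"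
  define p where "p = \<gamma> *\<^sub>R (H v *v v) - F v"
  have "e \<bullet> (\<gamma> *\<^sub>R (H v *v e) - p) = 0"
    using newton_dir_facts(5)[of v]
    by (simp add: e_def p_def matrix_vector_right_distrib algebra_simps)
  then have "\<gamma> * ((H v *v e) \<bullet> e) = e \<bullet> p"
    by (simp add: inner_diff_right inner_commute)
  then have "\<gamma> * (c * (norm e)\<^sup>2) \<le> norm e * norm p"
    using mult_left_mono[OF coerciveD[OF hessian_coercive, of e v], of \<gamma>] \<gamma>_pos norm_cauchy_schwarz[of e p]
    by simp
  then have "norm e * (\<gamma> * c * norm e) \<le> norm e * norm p"
    by (simp add: power2_eq_square mult_ac)
  then have "\<gamma> * c * norm e \<le> norm p"
    using norm_ge_zero[of p] by (cases "e = 0") auto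
  also have "norm p \<le> \<gamma> * norm (H v) * norm v + norm (F v)"
    using norm_triangle_ineq4[of "\<gamma> *\<^sub>R (H v *v v)" "F v"] norm_matrix_vector_le[of "H v" v] \<gamma>_pos
    by (simp add: p_def) (smt (verit) mult.assoc mult_left_mono)
  finally have "norm e \<le> (\<gamma> * norm (H v) * norm v + norm (F v)) / (\<gamma> * c)"
    using \<gamma>_pos c_pos by (simp add: field_simps)
  then show ?thesis
    using norm_triangle_ineq4[of e v] by (simp add: e_def)
qed

text \<open>If the complementarity problem is empty, the direction solves the Newton equation. Each
  coordinate then has \<open>q $ k = 0\<close> or \<open>(d + F) $ k = 0\<close>, so \<open>(d + F) \<bullet> q = 0\<close>, and coercivity bounds
  \<open>d\<close> by a multiple of \<open>F\<close>.\<close>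

lemma newton_dir_classical:
  assumes nd: "nondegenerate g w \<gamma> v" and I: "mod_I_plus g w \<gamma> v = {}" "mod_I_minus g w \<gamma> v = {}"
  shows "J v (d v) = - F v"
    and "norm (d v) \<le> (1 + \<gamma> * norm (H v)) / (\<gamma> * c) * norm (F v)"
proof -
  define q where "q = \<gamma> *\<^sub>R (H v *v d v) + F v"
  note facts = newton_dir_facts[where u = v, folded q_def]
  have A: "mod_A g w \<gamma> v = A_plus g w \<gamma> v \<union> A_minus g w \<gamma> v"
    and Z: "mod_I_zero g w \<gamma> v = I_zero g w \<gamma> v"
    using I by (auto simp: mod_A_def mod_A_plus_def mod_A_minus_def mod_I_zero_def mod_I_plus_def
        mod_I_minus_def)
  have k_cases: "k \<in> mod_A g w \<gamma> v \<or> k \<in> mod_I_zero g w \<gamma> v" for k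
    using nondegenerate_cover[OF nd] A Z by blast
  have qA: "q $ k = 0" if "k \<in> mod_A g w \<gamma> v" for k
    using facts(1) that .
  have dZ: "d v $ k + F v $ k = 0" if "k \<in> mod_I_zero g w \<gamma> v" for k
    using facts(2) that residual_cases(3)[of k v] by (simp add: Z)
  show "J v (d v) = - F v"
  proof (rule vec_eq_iff[THEN iffD2, rule_format])
    fix k
    show "J v (d v) $ k = (- F v) $ k"
      using k_cases[of k] qA[of k] dZ[of k] regime_disjoint[of v]
      unfolding A Z residual_deriv_def q_def by (auto simp: algebra_simps)
  qed
  have "(d v + F v) \<bullet> q = 0"
    unfolding inner_vec_def using k_cases qA dZ by (intro sum.neutral ballI) fastforce
  then have "\<gamma> * ((H v *v d v) \<bullet> d v)
      = - (d v \<bullet> F v) - \<gamma> * (F v \<bullet> (H v *v d v)) - F v \<bullet> F v"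
    by (simp add: q_def inner_add inner_commute algebra_simps)
  also have "\<dots> \<le> norm (d v) * norm (F v) + \<gamma> * (norm (F v) * (norm (H v) * norm (d v)))"
  proof -
    have "- (F v \<bullet> (H v *v d v)) \<le> norm (F v) * (norm (H v) * norm (d v))"
      using Cauchy_Schwarz_ineq2[of "F v" "H v *v d v"]
        mult_left_mono[OF norm_matrix_vector_le[of "H v" "d v"] norm_ge_zero[of "F v"]] by linarith
    then have "- (\<gamma> * (F v \<bullet> (H v *v d v))) \<le> \<gamma> * (norm (F v) * (norm (H v) * norm (d v)))"
      using \<gamma>_pos by (metis mult_left_mono mult_minus_right less_imp_le)
    then show ?thesis
      using Cauchy_Schwarz_ineq2[of "d v" "F v"] inner_ge_zero[of "F v"] by linarith
  qed
  finally have "\<gamma> * (c * (norm (d v))\<^sup>2)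
      \<le> norm (d v) * norm (F v) + \<gamma> * (norm (F v) * (norm (H v) * norm (d v)))"
    using mult_left_mono[OF coerciveD[OF hessian_coercive, of "d v" v], of \<gamma>] \<gamma>_pos
    by linarith
  then have "norm (d v) * (\<gamma> * c * norm (d v)) \<le> norm (d v) * ((1 + \<gamma> * norm (H v)) * norm (F v))"
    by (simp add: power2_eq_square algebra_simps)
  then have "\<gamma> * c * norm (d v) \<le> (1 + \<gamma> * norm (H v)) * norm (F v)"
    using \<gamma>_pos by (cases "d v = 0") auto
  then show "norm (d v) \<le> (1 + \<gamma> * norm (H v)) / (\<gamma> * c) * norm (F v)"
    using \<gamma>_pos c_pos by (simp add: field_simps)
qed

section \<open>The limit is a root\<close>

lemma eventually_less_add_one:
  fixes f :: "real^'n \<Rightarrow> real"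
  assumes "isCont f u" shows "\<forall>\<^sub>F v in nhds u. f v < f u + 1"
  using order_tendstoD(2)[OF isCont_tendsto_nhds[OF assms], of "f u + 1"] by simp

text \<open>The directional derivative of the merit function along \<open>d\<close> is at most \<open>-2\<close> times its value, and
  the error of this linear model is at most \<open>C \<tau>\<^sup>2\<close> with \<open>C\<close> independent of the point. A relaxed decrease
  with \<open>\<sigma> < 1\<close> is thus reached for all steps up to a length proportional to the
  value of the merit function, which stays away from \<open>0\<close> near \<open>u\<close>.\<close>

lemma armijo_uniform:
  assumes nd: "nondegenerate g w \<gamma> u" and pos: "0 < \<Theta> u" and \<sigma>: "0 < \<sigma>" "\<sigma> < 1"
  obtains \<tau>\<^sub>0 where "0 < \<tau>\<^sub>0"
    "\<forall>\<^sub>F v in nhds u. \<forall>\<tau>. 0 \<le> \<tau> \<longrightarrow> \<tau> \<le> \<tau>\<^sub>0 \<longrightarrow> \<Theta> (v + \<tau> *\<^sub>R d v) \<le> (1 - 2 * \<sigma> * \<tau>) * \<Theta> v"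
proof -
  let ?b = "\<lambda>v. norm v + (\<gamma> * norm (H v) * norm v + norm (F v)) / (\<gamma> * c)"
  have c0: "0 < \<gamma> * c"
    using \<gamma>_pos c_pos by simp
  \<comment> \<open>Near \<open>u\<close>, \<open>D\<close> bounds the direction, \<open>K\<close> the operator norm of \<open>J\<close>, \<open>f\<close> the residual, and for
    \<open>\<tau> \<le> 1\<close> all terms beyond the linear model sum up to at most \<open>C \<tau>\<^sup>2\<close>.\<close>
  define D where "D = ?b u + 1"
  define K where "K = \<gamma> * (norm (H u) + 1) + 1"
  define f where "f = norm (F u) + 1"
  define C where "C = (K * D)\<^sup>2 + 2 * (\<gamma> * L * D\<^sup>2) * (f + K * D) + (\<gamma> * L * D\<^sup>2)\<^sup>2"
  have D: "0 < D"
    unfolding D_def using c0 \<gamma>_pos by (intro add_nonneg_pos add_nonneg_nonneg divide_nonneg_pos) auto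
  have K: "0 < K"
    unfolding K_def using \<gamma>_pos by (simp add: add_nonneg_pos)
  have f: "0 < f"
    by (simp add: f_def add_nonneg_pos)
  have C: "0 \<le> C"
    unfolding C_def using D K f L_nonneg \<gamma>_pos by auto
  obtain r where r: "0 < r" "\<And>v. dist v u < r \<Longrightarrow> nondegenerate g w \<gamma> v \<and> same_regime g w \<gamma> u v"
    using eventually_same_regime[OF nd] unfolding eventually_nhds_metric by blast
  \<comment> \<open>The second bound keeps the step inside the region without ties; the third makes \<open>C \<tau>\<close> at most
    \<open>2 (1 - \<sigma>) \<Theta> v\<close> as long as \<open>\<Theta> v\<close> exceeds half of \<open>\<Theta> u\<close>.\<close>
  define \<tau>\<^sub>0 where "\<tau>\<^sub>0 = min 1 (min (r / (2 * D)) ((1 - \<sigma>) * \<Theta> u / (C + 1)))"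
  have \<tau>\<^sub>0: "0 < \<tau>\<^sub>0" "\<tau>\<^sub>0 \<le> 1" "\<tau>\<^sub>0 \<le> r / (2 * D)" "\<tau>\<^sub>0 \<le> (1 - \<sigma>) * \<Theta> u / (C + 1)"
    unfolding \<tau>\<^sub>0_def using r D C pos \<sigma> by (auto intro!: divide_pos_pos)
  have "isCont ?b u" "isCont (\<lambda>v. norm (H v)) u" "isCont (\<lambda>v. norm (F v)) u"
    using c0 by (auto intro!: continuous_intros continuous_data)
  note ev = this[THEN eventually_less_add_one]
  have ev_merit: "\<forall>\<^sub>F v in nhds u. \<Theta> u / 2 < \<Theta> v"
    using pos by (intro order_tendstoD(1)[OF isCont_tendsto_nhds] continuous_data) auto
  have ev_r: "\<forall>\<^sub>F v in nhds u. dist v u < r / 2"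
    using r(1) unfolding eventually_nhds_metric by (intro exI[of _ "r / 2"]) auto
  from ev ev_merit ev_r
  have "\<forall>\<^sub>F v in nhds u. \<forall>\<tau>. 0 \<le> \<tau> \<longrightarrow> \<tau> \<le> \<tau>\<^sub>0 \<longrightarrow> \<Theta> (v + \<tau> *\<^sub>R d v) \<le> (1 - 2 * \<sigma> * \<tau>) * \<Theta> v"
  proof eventually_elim
    case (elim v)
    show ?case
    proof (intro allI impI)
      fix \<tau> assume \<tau>: "0 \<le> \<tau>" "\<tau> \<le> \<tau>\<^sub>0"
      have dD: "norm (d v) \<le> D"
        using newton_dir_bound[of v] elim(1) by (simp add: D_def)
      have Ff: "norm (F v) \<le> f"
        using elim(3) by (simp add: f_def)
      have JK: "norm (J v (d v)) \<le> K * D"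
      proof -
        have "norm (J v (d v)) \<le> norm (\<gamma> *\<^sub>R (H v *v d v)) + norm (d v)"
          unfolding residual_deriv_def by (intro norm_triangle_le add_mono norm_subvec_le)
        also have "\<dots> \<le> \<gamma> * (norm (H v) * norm (d v)) + norm (d v)"
          using \<gamma>_pos norm_matrix_vector_le by simp
        also have "\<dots> = (\<gamma> * norm (H v) + 1) * norm (d v)"
          by (simp add: algebra_simps)
        also have "\<dots> \<le> K * D"
        proof (intro mult_mono dD)
          have "\<gamma> * norm (H v) \<le> \<gamma> * (norm (H u) + 1)"
            using elim(2) \<gamma>_pos by (intro mult_left_mono) auto
          then show "\<gamma> * norm (H v) + 1 \<le> K"
            by (simp add: K_def)
        qed (use K in auto)
        finally show ?thesis .
      qed
      define e where "e = F (v + \<tau> *\<^sub>R d v) - F v - J v (\<tau> *\<^sub>R d v)"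
      have J\<tau>: "J v (\<tau> *\<^sub>R d v) = \<tau> *\<^sub>R J v (d v)"
        by (simp add: residual_deriv_def matrix_vector_mult_scaleR subvec_scaleR scaleR_add_right mult_ac)
      have \<tau>D: "norm (\<tau> *\<^sub>R d v) \<le> \<tau> * D"
        using dD \<tau>(1) by (simp add: mult_left_mono)
      have "\<tau> * D \<le> r / 2"
        using \<tau>(2) \<tau>\<^sub>0(3) D by (simp add: field_simps) (smt (verit) mult_left_mono)
      then have "dist (v + \<tau> *\<^sub>R d v) u < r"
        using elim(5) \<tau>D norm_triangle_ineq[of "v - u" "\<tau> *\<^sub>R d v"] by (simp add: dist_norm algebra_simps)
      moreover have "dist v u < r"
        using elim(5) r(1) by simp
      ultimately have "nondegenerate g w \<gamma> v" "same_regime g w \<gamma> v (v + \<tau> *\<^sub>R d v)"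
        using r(2) unfolding same_regime_def by auto
      then have e: "norm e \<le> \<gamma> * L * (norm (\<tau> *\<^sub>R d v))\<^sup>2"
        unfolding e_def by (rule residual_taylor)
      also have "\<dots> \<le> \<gamma> * L * (\<tau> * D)\<^sup>2"
        using \<tau>D L_nonneg \<gamma>_pos by (intro mult_left_mono power_mono) auto
      finally have e: "norm e \<le> \<tau>\<^sup>2 * (\<gamma> * L * D\<^sup>2)"
        by (simp add: power_mult_distrib mult_ac)
      define b where "b = F v + \<tau> *\<^sub>R J v (d v)"
      have "norm b \<le> norm (F v) + \<tau> * norm (J v (d v))"
        unfolding b_def using norm_triangle_ineq[of "F v" "\<tau> *\<^sub>R J v (d v)"] \<tau> by simp
      also have "\<dots> \<le> f + 1 * (K * D)"
        using \<tau> \<tau>\<^sub>0(2) by (intro add_mono mult_mono Ff JK) auto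
      finally have b: "norm b \<le> f + K * D"
        by simp
      have "(norm b)\<^sup>2 = (norm (F v))\<^sup>2 + 2 * \<tau> * (F v \<bullet> J v (d v)) + \<tau>\<^sup>2 * (norm (J v (d v)))\<^sup>2"
        unfolding b_def power2_norm_eq_inner
        by (simp add: inner_add inner_commute power2_eq_square algebra_simps)
      also have "\<dots> \<le> (norm (F v))\<^sup>2 + 2 * \<tau> * (- (norm (F v))\<^sup>2) + \<tau>\<^sup>2 * (K * D)\<^sup>2"
        using \<tau> \<open>nondegenerate g w \<gamma> v\<close>
        by (intro add_mono mult_left_mono order_refl power_mono JK residual_descent) auto
      finally have b2: "(norm b)\<^sup>2 \<le> (1 - 2 * \<tau>) * \<Theta> v + \<tau>\<^sup>2 * (K * D)\<^sup>2"
        by (simp add: merit_def algebra_simps)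
      have "F (v + \<tau> *\<^sub>R d v) = b + e"
        by (simp add: e_def b_def J\<tau>)
      then have "\<Theta> (v + \<tau> *\<^sub>R d v) \<le> (norm b + norm e)\<^sup>2"
        unfolding merit_def by (simp add: power_mono norm_triangle_ineq)
      also have "\<dots> = (norm b)\<^sup>2 + 2 * (norm e * norm b) + (norm e)\<^sup>2"
        by (simp add: power2_eq_square algebra_simps)
      also have "\<dots> \<le> ((1 - 2 * \<tau>) * \<Theta> v + \<tau>\<^sup>2 * (K * D)\<^sup>2)
          + 2 * ((\<tau>\<^sup>2 * (\<gamma> * L * D\<^sup>2)) * (f + K * D)) + \<tau>\<^sup>2 * (\<gamma> * L * D\<^sup>2)\<^sup>2"
      proof (intro add_mono b2 mult_left_mono mult_mono e b)
        have "(norm e)\<^sup>2 \<le> (\<tau> * (\<gamma> * L * D\<^sup>2))\<^sup>2"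
        proof (intro power_mono norm_ge_zero)
          have "\<tau>\<^sup>2 \<le> \<tau>"
            using \<tau> \<tau>\<^sub>0(2) by (simp add: power2_eq_square mult_left_le)
          then have "\<tau>\<^sup>2 * (\<gamma> * L * D\<^sup>2) \<le> \<tau> * (\<gamma> * L * D\<^sup>2)"
            using L_nonneg \<gamma>_pos by (intro mult_right_mono) auto
          with e show "norm e \<le> \<tau> * (\<gamma> * L * D\<^sup>2)"
            by simp
        qed
        then show "(norm e)\<^sup>2 \<le> \<tau>\<^sup>2 * (\<gamma> * L * D\<^sup>2)\<^sup>2"
          by (simp add: power_mult_distrib)
      qed (use L_nonneg \<gamma>_pos in auto)
      also have "\<dots> = (1 - 2 * \<tau>) * \<Theta> v + \<tau> * (\<tau> * C)"
        by (simp add: C_def power2_eq_square algebra_simps)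
      also have "\<dots> \<le> (1 - 2 * \<tau>) * \<Theta> v + \<tau> * (2 * (1 - \<sigma>) * \<Theta> v)"
      proof (intro add_mono order_refl mult_left_mono \<tau>)
        have "\<tau> * C \<le> \<tau>\<^sub>0 * (C + 1)"
          using \<tau> C by (intro mult_mono) auto
        also have "\<dots> \<le> (1 - \<sigma>) * \<Theta> u"
          using \<tau>\<^sub>0(4) C by (simp add: field_simps)
        also have "\<dots> \<le> (1 - \<sigma>) * (2 * \<Theta> v)"
          using elim(4) \<sigma> by (intro mult_left_mono) auto
        finally show "\<tau> * C \<le> 2 * (1 - \<sigma>) * \<Theta> v"
          by (simp only: mult_ac)
      qed
      also have "\<dots> = (1 - 2 * \<sigma> * \<tau>) * \<Theta> v"
        by (simp add: algebra_simps)
      finally show "\<Theta> (v + \<tau> *\<^sub>R d v) \<le> (1 - 2 * \<sigma> * \<tau>) * \<Theta> v" .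
    qed
  qed
  with \<tau>\<^sub>0(1) show thesis
    by (rule that)
qed

text \<open>At a limit with \<open>\<Theta> u > 0\<close> one fixed power \<open>\<beta> ^ l\<close> would pass the Armijo test from some index on, so every
  later step would shrink the merit function by the factor \<open>1 - 2 \<sigma> \<beta> ^ l\<close> at least. In the limit this
  contradicts \<open>\<Theta> u > 0\<close>.\<close>

lemma limit_is_root:
  assumes nd: "nondegenerate g w \<gamma> u" and \<sigma>: "0 < \<sigma>" "\<sigma> < 1" and \<beta>: "0 < \<beta>" "\<beta> < 1"
    and run: "modBSSN g w \<gamma> \<beta> \<sigma> U t" and lim: "U \<longlonglongrightarrow> u"
  shows "F u = 0"
proof (rule ccontr)
  assume "F u \<noteq> 0"
  then have pos: "0 < \<Theta> u"
    by (simp add: merit_def)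
  obtain \<tau>\<^sub>0 where \<tau>\<^sub>0: "0 < \<tau>\<^sub>0" and ev:
    "\<forall>\<^sub>F v in nhds u. \<forall>\<tau>. 0 \<le> \<tau> \<longrightarrow> \<tau> \<le> \<tau>\<^sub>0 \<longrightarrow> \<Theta> (v + \<tau> *\<^sub>R d v) \<le> (1 - 2 * \<sigma> * \<tau>) * \<Theta> v"
    using armijo_uniform[OF nd pos \<sigma>] by blast
  obtain l where l: "\<beta> ^ l < \<tau>\<^sub>0"
    using real_arch_pow_inv[OF \<tau>\<^sub>0 \<beta>(2)] by blast
  have "\<forall>\<^sub>F j in sequentially. \<Theta> (U (Suc j)) \<le> (1 - 2 * \<sigma> * \<beta> ^ l) * \<Theta> (U j)"
    using filterlim_iff[THEN iffD1, OF lim, rule_format, OF ev]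
  proof eventually_elim
    case (elim j)
    then have "\<Theta> (U j + \<beta> ^ l *\<^sub>R d (U j)) \<le> (1 - 2 * \<sigma> * \<beta> ^ l) * \<Theta> (U j)"
      using l \<beta> by simp
    from armijo_stepsize_ge[OF \<beta> this] obtain m where m: "m \<le> l"
      "armijo_stepsize g w \<gamma> \<beta> \<sigma> (U j) = \<beta> ^ m"
      "\<Theta> (U j + \<beta> ^ m *\<^sub>R d (U j)) \<le> (1 - 2 * \<sigma> * \<beta> ^ m) * \<Theta> (U j)" .
    have "\<Theta> (U (Suc j)) \<le> (1 - 2 * \<sigma> * \<beta> ^ m) * \<Theta> (U j)"
      using run m unfolding modBSSN_def by simp
    also have "\<dots> \<le> (1 - 2 * \<sigma> * \<beta> ^ l) * \<Theta> (U j)"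
      using m(1) \<beta> \<sigma> by (intro mult_right_mono) (auto simp: merit_def power_decreasing)
    finally show ?case .
  qed
  moreover have "(\<lambda>j. \<Theta> (U j)) \<longlonglongrightarrow> \<Theta> u"
    by (rule isCont_tendsto_compose[OF continuous_data(4) lim])
  ultimately have "\<Theta> u \<le> (1 - 2 * \<sigma> * \<beta> ^ l) * \<Theta> u"
    by (intro tendsto_le[OF _ tendsto_mult_left LIMSEQ_Suc]) auto
  moreover have "0 < \<sigma> * \<beta> ^ l * \<Theta> u"
    using pos \<sigma> \<beta> by simp
  ultimately show False
    by (simp add: algebra_simps)
qed

section \<open>Full steps near a root\<close>

text \<open>At a root without ties the active coordinates and the thresholds of the inactive ones are nonzero
  with the sign that excludes the wrongly signed index sets, and continuity keeps these signs nearby.\<close>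

lemma eventually_classical:
  assumes nd: "nondegenerate g w \<gamma> u" and root: "F u = 0"
  shows "\<forall>\<^sub>F v in nhds u. mod_I_plus g w \<gamma> v = {} \<and> mod_I_minus g w \<gamma> v = {}"
proof -
  note lims = isCont_tendsto_nhds[OF continuous_data(5)] isCont_tendsto_nhds[OF continuous_data(6)]
    isCont_tendsto_nhds[OF continuous_component[OF continuous_ident]]
  have "\<forall>\<^sub>F v in nhds u. \<forall>k.
      (0 < u $ k \<longrightarrow> 0 < v $ k) \<and> (u $ k < 0 \<longrightarrow> v $ k < 0) \<and>
      (0 < upper g w \<gamma> u k \<longrightarrow> 0 < upper g w \<gamma> v k) \<and> (lower g w \<gamma> u k < 0 \<longrightarrow> lower g w \<gamma> v k < 0)"
    by (intro eventually_all_finite eventually_conj)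
      (auto simp: eventually_const_iff intro: order_tendstoD lims)
  with eventually_same_regime[OF nd] show ?thesis
  proof eventually_elim
    case (elim v)
    have root_k: "k \<in> A_plus g w \<gamma> u \<Longrightarrow> 0 < u $ k" "k \<in> A_minus g w \<gamma> u \<Longrightarrow> u $ k < 0"
      "k \<in> I_zero g w \<gamma> u \<Longrightarrow> lower g w \<gamma> u k < 0 \<and> 0 < upper g w \<gamma> u k" for k
      using residual_cases[of k u] root by (auto simp: A_plus_def A_minus_def I_zero_def)
    have sub: "A_plus_plus g w \<gamma> v \<subseteq> A_plus g w \<gamma> u" "A_minus_minus g w \<gamma> v \<subseteq> A_minus g w \<gamma> u"
      "I_zero_plus g w \<gamma> v \<subseteq> I_zero g w \<gamma> u" "I_zero_minus g w \<gamma> v \<subseteq> I_zero g w \<gamma> u"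
      using elim(1) unfolding same_regime_def
      by (auto simp: A_plus_def A_minus_def I_zero_def A_plus_plus_def A_minus_minus_def
          I_zero_plus_def I_zero_minus_def)
    have "\<not> v $ k < 0" if "k \<in> A_plus g w \<gamma> u" for k
      using root_k(1)[OF that] elim(2) by (meson order.asym)
    moreover have "\<not> 0 < v $ k" if "k \<in> A_minus g w \<gamma> u" for k
      using root_k(2)[OF that] elim(2) by (meson order.asym)
    moreover have "\<not> upper g w \<gamma> v k < 0 \<and> \<not> 0 < lower g w \<gamma> v k" if "k \<in> I_zero g w \<gamma> u" for k
      using root_k(3)[OF that] elim(2) by (meson order.asym)
    ultimately have "A_plus_plus g w \<gamma> v = {}" "A_minus_minus g w \<gamma> v = {}"
      "I_zero_plus g w \<gamma> v = {}" "I_zero_minus g w \<gamma> v = {}"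
      using sub unfolding A_plus_plus_def A_minus_minus_def I_zero_plus_def I_zero_minus_def
      by blast+
    then show ?case
      using elim(1) unfolding nondegenerate_def mod_I_plus_def mod_I_minus_def by blast
  qed
qed

text \<open>The linear part of the Taylor expansion cancels, so \<open>|F (v + d)| \<le> \<gamma> L |d|\<^sup>2 \<le> \<gamma> L C\<^sup>2 |F v|\<^sup>2\<close>, and the
  factor \<open>\<gamma> L C\<^sup>2 |F v|\<close> tends to \<open>0\<close> as \<open>v\<close> tends to the root.\<close>

lemma full_step_accepted:
  assumes nd: "nondegenerate g w \<gamma> u" and root: "F u = 0" and \<sigma>: "\<sigma> < 1 / 2"
  shows "\<forall>\<^sub>F v in nhds u. \<Theta> (v + d v) \<le> (1 - 2 * \<sigma>) * \<Theta> v"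
proof -
  define C where "C = (1 + \<gamma> * (norm (H u) + 1)) / (\<gamma> * c)"
  have C: "0 < C"
    unfolding C_def using \<gamma>_pos c_pos by (intro divide_pos_pos add_pos_nonneg) auto
  obtain r where r: "0 < r" "\<And>v. dist v u < r \<Longrightarrow> nondegenerate g w \<gamma> v \<and> same_regime g w \<gamma> u v"
    using eventually_same_regime[OF nd] unfolding eventually_nhds_metric by blast
  have F0: "((\<lambda>v. norm (F v)) \<longlongrightarrow> 0) (nhds u)"
    using isCont_tendsto_nhds[OF continuous_norm[OF continuous_data(3)], of u] root by simp
  have "((\<lambda>v. C * norm (F v)) \<longlongrightarrow> C * 0) (nhds u)"
    by (intro tendsto_intros F0)
  then have ev1: "\<forall>\<^sub>F v in nhds u. C * norm (F v) < r / 2"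
    using r(1) by (intro order_tendstoD(2)) auto
  have "((\<lambda>v. (\<gamma> * L * C\<^sup>2 * norm (F v))\<^sup>2) \<longlongrightarrow> (\<gamma> * L * C\<^sup>2 * 0)\<^sup>2) (nhds u)"
    by (intro tendsto_intros F0)
  then have ev2: "\<forall>\<^sub>F v in nhds u. (\<gamma> * L * C\<^sup>2 * norm (F v))\<^sup>2 < 1 - 2 * \<sigma>"
    by (rule order_tendstoD(2)) (use \<sigma> in simp)
  have ev3: "\<forall>\<^sub>F v in nhds u. norm (H v) < norm (H u) + 1"
    by (intro eventually_less_add_one continuous_intros continuous_data)
  have ev4: "\<forall>\<^sub>F v in nhds u. dist v u < r / 2"
    using r(1) unfolding eventually_nhds_metric by (intro exI[of _ "r / 2"]) auto
  from ev1 ev2 ev3 ev4 eventually_classical[OF nd root] show ?thesis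
  proof eventually_elim
    case (elim v)
    have "dist v u < r"
      using elim(4) r(1) by simp
    then have v: "nondegenerate g w \<gamma> v" "same_regime g w \<gamma> u v"
      using r(2) by auto
    note classical = newton_dir_classical[OF v(1) conjunct1[OF elim(5)] conjunct2[OF elim(5)]]
    have "\<gamma> * norm (H v) \<le> \<gamma> * (norm (H u) + 1)"
      using elim(3) \<gamma>_pos by (intro mult_left_mono) auto
    then have "(1 + \<gamma> * norm (H v)) / (\<gamma> * c) \<le> C"
      unfolding C_def using \<gamma>_pos c_pos by (intro divide_right_mono) auto
    then have dC: "norm (d v) \<le> C * norm (F v)"
      using classical(2) by (meson mult_right_mono norm_ge_zero order_trans)
    have "dist (v + d v) u < r"
      using dC elim(1,4) norm_triangle_ineq[of "v - u" "d v"] by (simp add: dist_norm algebra_simps)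
    then have "same_regime g w \<gamma> v (v + d v)"
      using r(2)[of "v + d v"] v(2) by (simp add: same_regime_def)
    then have "norm (F (v + d v)) \<le> \<gamma> * L * (norm (d v))\<^sup>2"
      using residual_taylor[OF v(1), of "d v"] classical(1) by simp
    also have "\<dots> \<le> \<gamma> * L * (C * norm (F v))\<^sup>2"
      using dC \<gamma>_pos L_nonneg by (intro mult_left_mono power_mono) auto
    also have "\<dots> = (\<gamma> * L * C\<^sup>2 * norm (F v)) * norm (F v)"
      by (simp add: power2_eq_square mult_ac)
    finally have "\<Theta> (v + d v) \<le> ((\<gamma> * L * C\<^sup>2 * norm (F v)) * norm (F v))\<^sup>2"
      unfolding merit_def by (rule power_mono) simp
    also have "\<dots> = (\<gamma> * L * C\<^sup>2 * norm (F v))\<^sup>2 * \<Theta> v"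
      by (simp add: power_mult_distrib merit_def)
    also have "\<dots> \<le> (1 - 2 * \<sigma>) * \<Theta> v"
      using elim(2) by (intro mult_right_mono) (auto simp: merit_def)
    finally show ?case .
  qed
qed

lemma eventually_unit_stepsize:
  assumes nd: "nondegenerate g w \<gamma> u" and \<sigma>: "0 < \<sigma>" "\<sigma> < 1 / 2" and \<beta>: "0 < \<beta>" "\<beta> < 1"
    and run: "modBSSN g w \<gamma> \<beta> \<sigma> U t" and lim: "U \<longlonglongrightarrow> u"
  shows "\<forall>\<^sub>F j in sequentially. t j = 1"
proof -
  have "F u = 0"
    using limit_is_root[OF nd _ _ \<beta> run lim] \<sigma> by simp
  from full_step_accepted[OF nd this \<sigma>(2)] lim
  have "\<forall>\<^sub>F j in sequentially. \<Theta> (U j + d (U j)) \<le> (1 - 2 * \<sigma>) * \<Theta> (U j)"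
    unfolding filterlim_iff by blast
  then show ?thesis
  proof eventually_elim
    case (elim j)
    then have "\<Theta> (U j + \<beta> ^ 0 *\<^sub>R d (U j)) \<le> (1 - 2 * \<sigma> * \<beta> ^ 0) * \<Theta> (U j)"
      by simp
    from armijo_stepsize_ge[OF \<beta> this] have "armijo_stepsize g w \<gamma> \<beta> \<sigma> (U j) = 1"
      by (metis le_zero_eq power_0)
    then show ?case
      using run by (simp add: modBSSN_def)
  qed
qed

end

theorem theorem13:
  fixes g :: "real^'n::finite \<Rightarrow> real"
    and w :: "real^'n"
    and \<gamma> \<beta> \<sigma> :: real
    and u :: "nat \<Rightarrow> real^'n"
    and t :: "nat \<Rightarrow> real"
    and u_star :: "real^'n"
  assumes "strictly_convex_on UNIV g"
    and "\<forall>k. w $ k > 0"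
    and "\<gamma> > 0"
    and "\<forall>v. g differentiable (at v)"
    and "\<forall>v. gradient g differentiable (at v)"
    and "\<exists>L. L-lipschitz_on UNIV (hessian g)"
    and "\<forall>v. positive_definite (hessian g v)"
    and "\<exists>c1>0. \<exists>c2>0. \<forall>v h. c1 * (norm h)\<^sup>2 \<le> (hessian g v *v h) \<bullet> h \<and>
           (hessian g v *v h) \<bullet> h \<le> c2 * (norm h)\<^sup>2"
    and "\<forall>u0. compact {v. merit g w \<gamma> v \<le> merit g w \<gamma> u0}"
    and "continuously_differentiable 3 g"
    and "0 < \<beta>" "\<beta> < 1"
    and "0 < \<sigma>" "\<sigma> < 1 / 2"
    and "modBSSN g w \<gamma> \<beta> \<sigma> u t"
    and "u \<longlonglongrightarrow> u_star"
    and "I_plus g w \<gamma> u_star \<union> I_minus g w \<gamma> u_star = {}"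
  shows "\<exists>j0. \<forall>j\<ge>j0. t j = 1"
proof -
  obtain c where c: "\<And>v. coercive c (hessian g v)"
    using assms(8) unfolding coercive_def by blast
  obtain L where L: "L-lipschitz_on UNIV (hessian g)"
    using assms(6) by blast
  have w: "\<And>k. 0 < w $ k" and grad: "\<And>v. gradient g differentiable (at v)"
    using assms(2,5) by auto
  have nd: "nondegenerate g w \<gamma> u_star"
    using assms(17) by (simp add: nondegenerate_def)
  show ?thesis
    using eventually_unit_stepsize[OF w assms(3) grad L c nd assms(13,14,11,12,15,16)]
    by (simp add: eventually_sequentially)
qed

end
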